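(* Let $n\ge 1$, $\Theta\subseteq\mathsf{FORM}_n$ and $\psi\in\mathsf{FORM}_n$. Then $\Theta\models_\partial\psi$ if and only if $\Theta\vdash\psi$.
   Context: $\mathsf{FORM}_n$ is the set of formulas of infinite-valued Łukasiewicz propositional logic $\text{Ł}_\infty$ in the variables $X_1,\dots,X_n$, and $\Theta\vdash\psi$ means $\psi$ is derivable from $\Theta$ using the Łukasiewicz axioms and Modus Ponens. Each $\phi\in\mathsf{FORM}_n$ determines a function $\hat\phi\colon[0,1]^n\to[0,1]$: a point $v\in[0,1]^n$ assigns $v_i$ to $X_i$ and $\hat\phi(v)$ is the truth value of $\phi$ computed with $\neg x=1-x$, $x\oplus y=\min(1,x+y)$. Differential valuation (in $\mathbb R^n$): for $0\le t\le n$, a tuple $U=(u_0,u_1,\dots,u_t)$ of vectors in $\mathbb R^n$ with $u_1,\dots,u_t$ pairwise orthogonal unit vectors, such that for all sufficiently large integers $m$ the simplex $T_{U,m}=\mathrm{conv}(u_0,\,u_0+u_1/m,\,u_0+u_1/m+u_2/m^2,\dots,u_0+u_1/m+\cdots+u_t/m^t)$ is contained in $[0,1]^n$. $U$ satisfies a formula $\psi$ if there is $m$ such that $\hat\psi=1$ on all of $T_{U,m}$. Stable consequence: $\Theta\models_\partial\psi$ iff every differential valuation in $\mathbb R^n$ satisfying every $\theta\in\Theta$ also satisfies $\psi$. *)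

theory Defs
  imports "HOL-Analysis.Analysis"
begin

text \<open>The primitive connectives are negation and implication, the ones in which the Lukasiewicz
  axioms are written; \<open>A \<oplus> B\<close> stands for the formula \<open>\<not> A \<rightarrow> B\<close>. Formulas in
  \<open>X\<^sub>1, \<dots>, X\<^sub>n\<close> are formulas over a finite type of variables with \<open>n\<close> elements.\<close>

datatype 'v form = Var 'v | Neg "'v form" | Imp "'v form" "'v form" (infixr "\<^bold>\<rightarrow>" 60)

definition Oplus :: "'v form \<Rightarrow> 'v form \<Rightarrow> 'v form" (infixr "\<^bold>\<oplus>" 65) where
  "A \<^bold>\<oplus> B = (Neg A \<^bold>\<rightarrow> B)"

inductive luk_axiom :: "'v form \<Rightarrow> bool" where
  A1: "luk_axiom (A \<^bold>\<rightarrow> B \<^bold>\<rightarrow> A)"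
| A2: "luk_axiom ((A \<^bold>\<rightarrow> B) \<^bold>\<rightarrow> (B \<^bold>\<rightarrow> C) \<^bold>\<rightarrow> A \<^bold>\<rightarrow> C)"
| A3: "luk_axiom (((A \<^bold>\<rightarrow> B) \<^bold>\<rightarrow> B) \<^bold>\<rightarrow> (B \<^bold>\<rightarrow> A) \<^bold>\<rightarrow> A)"
| A4: "luk_axiom ((Neg A \<^bold>\<rightarrow> Neg B) \<^bold>\<rightarrow> B \<^bold>\<rightarrow> A)"

inductive derives :: "'v form set \<Rightarrow> 'v form \<Rightarrow> bool" (infix "\<turnstile>" 50) for \<Theta> where
  ax: "luk_axiom A \<Longrightarrow> \<Theta> \<turnstile> A"
| hyp: "A \<in> \<Theta> \<Longrightarrow> \<Theta> \<turnstile> A"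
| mp: "\<Theta> \<turnstile> A \<Longrightarrow> \<Theta> \<turnstile> A \<^bold>\<rightarrow> B \<Longrightarrow> \<Theta> \<turnstile> B"

definition mv_neg :: "real \<Rightarrow> real" where
  "mv_neg x = 1 - x"

definition mv_oplus :: "real \<Rightarrow> real \<Rightarrow> real" where
  "mv_oplus x y = min 1 (x + y)"

primrec truth_value :: "'n form \<Rightarrow> real ^ 'n \<Rightarrow> real" where
  "truth_value (Var i) v = v $ i"
| "truth_value (Neg A) v = mv_neg (truth_value A v)"
| "truth_value (A \<^bold>\<rightarrow> B) v = mv_oplus (mv_neg (truth_value A v)) (truth_value B v)"

lemma truth_value_Oplus:
  "truth_value (A \<^bold>\<oplus> B) v = mv_oplus (truth_value A v) (truth_value B v)"
  by (simp add: Oplus_def mv_neg_def)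

definition unit_cube :: "(real ^ 'n) set" where
  "unit_cube = {v. \<forall>i. 0 \<le> v $ i \<and> v $ i \<le> 1}"

text \<open>A tuple \<open>(u\<^sub>0, \<dots>, u\<^sub>t)\<close> is a list of length \<open>t + 1\<close>.\<close>

definition dv_vertex :: "(real ^ 'n) list \<Rightarrow> nat \<Rightarrow> nat \<Rightarrow> real ^ 'n" where
  "dv_vertex U m k = (\<Sum>i\<le>k. (1 / real m ^ i) *\<^sub>R (U ! i))"

definition dv_simplex :: "(real ^ 'n) list \<Rightarrow> nat \<Rightarrow> (real ^ 'n) set" where
  "dv_simplex U m = convex hull (dv_vertex U m ` {..<length U})"

definition differential_valuation :: "(real ^ 'n) list \<Rightarrow> bool" where
  "differential_valuation U \<longleftrightarrow>
     (\<exists>t \<le> CARD('n). length U = t + 1 \<and>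
        (\<forall>i\<in>{1..t}. norm (U ! i) = 1) \<and>
        (\<forall>i\<in>{1..t}. \<forall>j\<in>{1..t}. i \<noteq> j \<longrightarrow> orthogonal (U ! i) (U ! j))) \<and>
     (\<forall>\<^sub>F m in sequentially. dv_simplex U m \<subseteq> unit_cube)"

text \<open>The case \<open>m = 0\<close> is excluded because division by zero would collapse the simplex to
  \<open>{u\<^sub>0}\<close>; the simplex has to lie in the cube, the domain of the function of a formula.\<close>

definition dv_satisfies :: "(real ^ 'n) list \<Rightarrow> 'n form \<Rightarrow> bool" where
  "dv_satisfies U \<psi> \<longleftrightarrow>
     (\<exists>m\<ge>1. dv_simplex U m \<subseteq> unit_cube \<and> (\<forall>v\<in>dv_simplex U m. truth_value \<psi> v = 1))"

definition stable_consequence :: "('n::finite) form set \<Rightarrow> 'n form \<Rightarrow> bool" (infix "\<Turnstile>\<^sub>\<partial>" 50) where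
  "\<Theta> \<Turnstile>\<^sub>\<partial> \<psi> \<longleftrightarrow>
     (\<forall>U. differential_valuation U \<longrightarrow> (\<forall>\<theta>\<in>\<Theta>. dv_satisfies U \<theta>) \<longrightarrow> dv_satisfies U \<psi>)"

end

theory Submission imports Defs "HOL-Library.Multiset" begin

text \<open>Soundness holds because the simplices of a differential valuation shrink as \<open>m\<close> grows.
  For completeness, extend \<open>\<Theta>\<close> to a theory \<open>T\<close> maximal among those not proving \<open>\<psi>\<close>;
  prelinearity makes its Lindenbaum algebra a chain. The chain is the unit interval of a totally
  ordered abelian group with unit, generated by the variables and the unit, so it induces a total
  group preorder on \<open>\<int>\<^sup>n\<^sup>+\<^sup>1\<close>. Repeated separation of the negative elements from the origin
  turns this preorder into the lexicographic order of finitely many linear functionals. The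
  first one, normalised at the unit, is evaluation at a point \<open>u\<^sub>0\<close> of the cube; the others are
  orthonormal vectors \<open>u\<^sub>1, \<dots>, u\<^sub>t\<close>. An integral affine function is nonnegative on
  the simplices of \<open>(u\<^sub>0, \<dots>, u\<^sub>t)\<close> for large \<open>m\<close> iff it is nonnegative in the preorder, so
  this differential valuation satisfies exactly the formulas that \<open>T\<close> proves.\<close>

section \<open>Truncated difference and the ordered group of a chain\<close>

text \<open>With \<open>x \<ominus> y\<close> read as "y implies x" and \<open>Z\<close> as
  derivability, the assumptions are \<open>A1\<close>, \<open>A2\<close>, \<open>A3\<close>, modus
  ponens and ex falso. A vanishing predicate replaces equality with zero, so no quotient by provable
  equivalence is formed and identities are stated for \<open>\<doteq>\<close>.\<close>

locale bounded_bck =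
  fixes mns :: "'a \<Rightarrow> 'a \<Rightarrow> 'a" (infixl "\<ominus>" 65)
    and Z :: "'a \<Rightarrow> bool" and one :: 'a
  assumes Z_mns_mns: "Z ((x \<ominus> y) \<ominus> x)"
    and Z_mns_anti: "Z (((z \<ominus> x) \<ominus> (z \<ominus> y)) \<ominus> (y \<ominus> x))"
    and Z_inf_commute: "Z ((x \<ominus> (x \<ominus> y)) \<ominus> (y \<ominus> (y \<ominus> x)))"
    and Z_mp: "Z x \<Longrightarrow> Z (y \<ominus> x) \<Longrightarrow> Z y"
    and Z_mns_one: "Z (x \<ominus> one)"
begin

definition le (infix "\<preceq>" 50) where "x \<preceq> y \<longleftrightarrow> Z (x \<ominus> y)"
definition eqv (infix "\<doteq>" 50) where "x \<doteq> y \<longleftrightarrow> x \<preceq> y \<and> y \<preceq> x"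

lemma Z_le: "x \<preceq> y \<Longrightarrow> Z y \<Longrightarrow> Z x"
  unfolding le_def by (rule Z_mp)

lemma le_one: "x \<preceq> one"
  by (simp add: le_def Z_mns_one)

lemma mns_le: "x \<ominus> y \<preceq> x"
  by (simp add: le_def Z_mns_mns)

lemma mns_mono_right: "y \<preceq> x \<Longrightarrow> z \<ominus> x \<preceq> z \<ominus> y"
  using Z_mns_anti Z_mp unfolding le_def by blast

lemma le_trans [trans]: "x \<preceq> y \<Longrightarrow> y \<preceq> z \<Longrightarrow> x \<preceq> z"
  using Z_mns_anti Z_mp unfolding le_def by blast

text \<open>In the unit interval \<open>x \<ominus> (x \<ominus> y)\<close> is the minimum of
  \<open>x\<close> and \<open>y\<close>; it serves as the meet throughout.\<close>

lemma inf_le: "x \<ominus> (x \<ominus> y) \<preceq> y"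
  using le_trans[OF _ mns_le] Z_inf_commute unfolding le_def by blast

lemma mns_exchange_le: "(x \<ominus> y) \<ominus> z \<preceq> (x \<ominus> z) \<ominus> y"
proof -
  have "(x \<ominus> y) \<ominus> z \<preceq> (x \<ominus> y) \<ominus> (x \<ominus> (x \<ominus> z))"
    by (rule mns_mono_right[OF inf_le])
  also have "\<dots> \<preceq> (x \<ominus> z) \<ominus> y"
    by (simp add: le_def Z_mns_anti)
  finally show ?thesis .
qed

text \<open>Exchange turns the vanishing of \<open>(x \<ominus> y) \<ominus> x\<close> into that of
  \<open>(x \<ominus> x) \<ominus> y\<close> for every \<open>y\<close>; choose \<open>y\<close>
  vanishing.\<close>

lemma le_refl: "x \<preceq> x"
  unfolding le_def using Z_le[OF mns_exchange_le Z_mns_mns] Z_mns_mns Z_mp by blast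

lemma mns_mono_left: "x \<preceq> y \<Longrightarrow> x \<ominus> z \<preceq> y \<ominus> z"
  using mns_exchange_le Z_mns_anti Z_mp Z_le unfolding le_def by blast

lemma Z_imp_le: "Z x \<Longrightarrow> x \<preceq> y"
  using Z_le[OF mns_le] by (simp add: le_def)

lemma eqv_refl: "x \<doteq> x"
  by (simp add: eqv_def le_refl)

lemma eqv_sym [sym]: "x \<doteq> y \<Longrightarrow> y \<doteq> x"
  by (simp add: eqv_def)

lemma eqv_trans [trans]: "x \<doteq> y \<Longrightarrow> y \<doteq> z \<Longrightarrow> x \<doteq> z"
  unfolding eqv_def using le_trans by blast

lemma eqv_le_trans [trans]: "x \<doteq> y \<Longrightarrow> y \<preceq> z \<Longrightarrow> x \<preceq> z"
  unfolding eqv_def using le_trans by blast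

lemma le_eqv_trans [trans]: "x \<preceq> y \<Longrightarrow> y \<doteq> z \<Longrightarrow> x \<preceq> z"
  unfolding eqv_def using le_trans by blast

lemma eqv_mns: "x \<doteq> x' \<Longrightarrow> y \<doteq> y' \<Longrightarrow> x \<ominus> y \<doteq> x' \<ominus> y'"
  unfolding eqv_def using mns_mono_left mns_mono_right le_trans by blast

lemma eqv_mns_left: "x \<doteq> x' \<Longrightarrow> x \<ominus> y \<doteq> x' \<ominus> y"
  by (rule eqv_mns[OF _ eqv_refl])

lemma eqv_mns_right: "y \<doteq> y' \<Longrightarrow> x \<ominus> y \<doteq> x \<ominus> y'"
  by (rule eqv_mns[OF eqv_refl])

lemma mns_exchange: "(x \<ominus> y) \<ominus> z \<doteq> (x \<ominus> z) \<ominus> y"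
  by (simp add: eqv_def mns_exchange_le)

lemma inf_commute: "x \<ominus> (x \<ominus> y) \<doteq> y \<ominus> (y \<ominus> x)"
  by (simp add: eqv_def le_def Z_inf_commute)

lemma mns_Z: "Z y \<Longrightarrow> x \<ominus> y \<doteq> x"
  unfolding eqv_def using mns_le Z_mp[of y] inf_le[of x y] le_def by blast

lemma Z_cong: "x \<doteq> y \<Longrightarrow> Z x \<longleftrightarrow> Z y"
  unfolding eqv_def using Z_le by blast

lemma inf_absorb: "x \<preceq> y \<Longrightarrow> y \<ominus> (y \<ominus> x) \<doteq> x"
  using eqv_trans[OF inf_commute mns_Z] by (simp add: le_def)

lemma mns_mns_one: "one \<ominus> (one \<ominus> x) \<doteq> x"
  by (rule inf_absorb[OF le_one])

lemma mns_contra: "(one \<ominus> y) \<ominus> (one \<ominus> x) \<doteq> x \<ominus> y"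
  by (rule eqv_trans[OF mns_exchange eqv_mns_left[OF mns_mns_one]])

lemma one_mns_le_iff: "one \<ominus> y \<preceq> one \<ominus> x \<longleftrightarrow> x \<preceq> y"
  using Z_cong[OF mns_contra] by (simp add: le_def)

text \<open>In the unit interval both sides are \<open>x\<close> minus the maximum of
  \<open>y\<close> and \<open>a\<close>, cut off at 0. Complements turn this maximum into a meet,
  which commutes.\<close>

lemma mns_sup_sym: "(x \<ominus> y) \<ominus> (a \<ominus> y) \<doteq> (x \<ominus> a) \<ominus> (y \<ominus> a)"
proof -
  let ?n = "\<lambda>x. one \<ominus> x"
  have "(x \<ominus> y) \<ominus> (a \<ominus> y) \<doteq> (?n y \<ominus> ?n x) \<ominus> (?n y \<ominus> ?n a)"
    by (intro eqv_mns eqv_sym[OF mns_contra])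
  also have "\<dots> \<doteq> (?n y \<ominus> (?n y \<ominus> ?n a)) \<ominus> ?n x"
    by (rule mns_exchange)
  also have "\<dots> \<doteq> (?n a \<ominus> (?n a \<ominus> ?n y)) \<ominus> ?n x"
    by (rule eqv_mns_left[OF inf_commute])
  also have "\<dots> \<doteq> (?n a \<ominus> ?n x) \<ominus> (?n a \<ominus> ?n y)"
    by (rule mns_exchange)
  also have "\<dots> \<doteq> (x \<ominus> a) \<ominus> (y \<ominus> a)"
    by (intro eqv_mns mns_contra)
  finally show ?thesis .
qed

text \<open>The meet of the two differences vanishes. The element \<open>a\<close> is chosen so that
  exchange brings the meet into the form of \<open>mns_sup_sym\<close>; after the symmetry,
  \<open>x \<ominus> a\<close> is a meet lying below \<open>y \<ominus> x\<close>, and the bound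
  shrinks to \<open>a \<ominus> x\<close>.\<close>

lemma prelinearity: "Z ((x \<ominus> y) \<ominus> ((x \<ominus> y) \<ominus> (y \<ominus> x)))"
proof -
  define a where "a = x \<ominus> (y \<ominus> x)"
  have "(x \<ominus> y) \<ominus> ((x \<ominus> y) \<ominus> (y \<ominus> x)) \<doteq> (x \<ominus> y) \<ominus> (a \<ominus> y)"
    unfolding a_def by (rule eqv_mns_right[OF mns_exchange])
  also have "\<dots> \<doteq> (x \<ominus> a) \<ominus> (y \<ominus> a)"
    by (rule mns_sup_sym)
  also have "\<dots> \<preceq> (y \<ominus> x) \<ominus> (y \<ominus> a)"
    unfolding a_def by (rule mns_mono_left[OF inf_le])
  also have "\<dots> \<doteq> (y \<ominus> (y \<ominus> a)) \<ominus> x"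
    by (rule mns_exchange)
  also have "\<dots> \<preceq> a \<ominus> x"
    by (rule mns_mono_left[OF inf_le])
  finally show ?thesis
    by (rule Z_le) (simp add: a_def Z_mns_mns)
qed

text \<open>In the unit interval both sides are b + c - a, cut off at 0.\<close>

lemma mns_le_swap:
  assumes "b \<preceq> a" "c \<preceq> a"
  shows "b \<ominus> (a \<ominus> c) \<doteq> c \<ominus> (a \<ominus> b)"
proof -
  have "b \<ominus> (a \<ominus> c) \<doteq> (a \<ominus> (a \<ominus> b)) \<ominus> (a \<ominus> c)"
    by (rule eqv_mns_left[OF eqv_sym[OF inf_absorb[OF assms(1)]]])
  also have "\<dots> \<doteq> (a \<ominus> (a \<ominus> c)) \<ominus> (a \<ominus> b)"
    by (rule mns_exchange)
  also have "\<dots> \<doteq> c \<ominus> (a \<ominus> b)"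
    by (rule eqv_mns_left[OF inf_absorb[OF assms(2)]])
  finally show ?thesis .
qed

lemma mns_mns_cancel:
  assumes "z \<preceq> y" "y \<preceq> x"
  shows "(x \<ominus> z) \<ominus> (y \<ominus> z) \<doteq> x \<ominus> y"
proof -
  have "z \<preceq> x" using assms le_trans by blast
  have "y \<ominus> z \<doteq> (x \<ominus> (x \<ominus> y)) \<ominus> (x \<ominus> (x \<ominus> z))"
    by (intro eqv_mns eqv_sym[OF inf_absorb] assms \<open>z \<preceq> x\<close>)
  also have "\<dots> \<doteq> (x \<ominus> (x \<ominus> (x \<ominus> z))) \<ominus> (x \<ominus> y)"
    by (rule mns_exchange)
  also have "\<dots> \<doteq> (x \<ominus> z) \<ominus> (x \<ominus> y)"
    by (rule eqv_mns_left[OF inf_absorb[OF mns_le]])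
  finally have "(x \<ominus> z) \<ominus> (y \<ominus> z) \<doteq> (x \<ominus> z) \<ominus> ((x \<ominus> z) \<ominus> (x \<ominus> y))"
    by (rule eqv_mns_right)
  also have "\<dots> \<doteq> x \<ominus> y"
    by (rule inf_absorb[OF mns_mono_right[OF assms(1)]])
  finally show ?thesis .
qed

end

section \<open>The ordered group of a chain: addition with carry\<close>

locale bck_chain = bounded_bck +
  assumes total: "Z (x \<ominus> y) \<or> Z (y \<ominus> x)"
    and not_Z_one: "\<not> Z one"
begin

lemma le_total: "x \<preceq> y \<or> y \<preceq> x"
  using total by (simp add: le_def)

text \<open>A pair \<open>(n, a)\<close> with \<open>a\<close> nonzero stands for the element \<open>n + 1 - a\<close> of the ordered
  group of the chain; \<open>step\<close> adds an element of the chain to it.\<close>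

fun step :: "nat \<times> 'a \<Rightarrow> 'a \<Rightarrow> nat \<times> 'a" where
  "step (n, a) b = (if a \<preceq> b then (Suc n, one \<ominus> (b \<ominus> a)) else (n, a \<ominus> b))"

fun sle :: "nat \<times> 'a \<Rightarrow> nat \<times> 'a \<Rightarrow> bool" where
  "sle (n, a) (m, b) \<longleftrightarrow> n < m \<or> n = m \<and> b \<preceq> a"

text \<open>A nonzero \<open>a\<close> places n + 1 - a in the half-open interval from n to n + 1.
  Hence the value determines the first component, and \<open>sle\<close> may compare
  lexicographically.\<close>

definition proper :: "nat \<times> 'a \<Rightarrow> bool" where
  "proper s \<longleftrightarrow> \<not> Z (snd s)"

lemma sle_trans: "sle s t \<Longrightarrow> sle t u \<Longrightarrow> sle s u"
  by (cases s; cases t; cases u) (auto intro: le_trans)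

lemma sle_refl: "sle s s"
  by (cases s) (auto intro: le_refl)

lemma sle_total: "sle s t \<or> sle t s"
  using le_total by (cases s; cases t) auto

lemma not_mns_self_le: "\<not> Z a \<Longrightarrow> a \<preceq> b \<Longrightarrow> \<not> b \<preceq> b \<ominus> a"
  using Z_cong[OF inf_absorb[of a b]] by (simp add: le_def)

lemma proper_step: "proper s \<Longrightarrow> proper (step s b)"
proof (cases s)
  case (Pair n a)
  assume "proper s"
  then have a: "\<not> Z a" using Pair by (simp add: proper_def)
  have "\<not> Z (one \<ominus> (b \<ominus> a))" if "a \<preceq> b"
    using not_mns_self_le[OF a that] le_trans[OF le_one] le_def by blast
  then show ?thesis using Pair by (auto simp: proper_def le_def)
qed

lemma step_mono: "sle s t \<Longrightarrow> sle (step s b) (step t b)"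
proof (cases s; cases t)
  fix n a m c
  assume s: "sle s t" "s = (n, a)" "t = (m, c)"
  have "c \<ominus> b \<preceq> one \<ominus> (b \<ominus> a)"
    using le_trans[OF mns_mono_left[OF le_one] mns_mono_right[OF mns_le]] .
  moreover have "c \<preceq> a \<Longrightarrow> a \<preceq> b \<Longrightarrow> c \<preceq> b" by (rule le_trans)
  moreover have "c \<preceq> a \<Longrightarrow> one \<ominus> (b \<ominus> c) \<preceq> one \<ominus> (b \<ominus> a)"
    by (intro mns_mono_right)
  ultimately show ?thesis using s mns_mono_left by auto
qed

text \<open>This is cancellation, by cases on the carries: facts 1 and 4 are for a carry in
  \<open>t\<close> only, 2 for carries in both, 3 for none. With a carry in \<open>s\<close> only,
  the first components decide.\<close>

lemma step_strict_mono:
  assumes "proper s" "proper t" "sle (step s b) (step t b)"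
  shows "sle s t"
proof (cases s; cases t)
  fix n a m c
  assume s: "s = (n, a)" "t = (m, c)"
  have ac: "\<not> Z a" "\<not> Z c" using assms s by (auto simp: proper_def)
  have 1: "\<not> one \<ominus> (b \<ominus> c) \<preceq> a \<ominus> b" if "c \<preceq> b"
  proof
    assume "one \<ominus> (b \<ominus> c) \<preceq> a \<ominus> b"
    then have "one \<ominus> (b \<ominus> c) \<preceq> one \<ominus> b"
      using le_trans[OF _ mns_mono_left[OF le_one]] by blast
    then show False using not_mns_self_le[OF ac(2) that] by (simp add: one_mns_le_iff)
  qed
  have 2: "c \<preceq> a" if "c \<preceq> b" "a \<preceq> b" "one \<ominus> (b \<ominus> c) \<preceq> one \<ominus> (b \<ominus> a)"
  proof -
    have "b \<ominus> (b \<ominus> c) \<preceq> b \<ominus> (b \<ominus> a)"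
      using that(3) by (simp add: one_mns_le_iff mns_mono_right)
    then show ?thesis
      using inf_absorb[OF that(1)] inf_absorb[OF that(2)] eqv_sym le_eqv_trans eqv_le_trans by blast
  qed
  have 3: "c \<preceq> a" if "\<not> c \<preceq> b" "\<not> a \<preceq> b" "c \<ominus> b \<preceq> a \<ominus> b"
  proof -
    let ?n = "\<lambda>x. one \<ominus> x"
    have le: "?n c \<preceq> ?n b" "?n a \<preceq> ?n b"
      using that le_total by (auto simp: one_mns_le_iff)
    have "?n b \<ominus> ?n c \<preceq> ?n b \<ominus> ?n a"
      using that(3) mns_contra eqv_sym le_eqv_trans eqv_le_trans by blast
    then have "?n b \<ominus> (?n b \<ominus> ?n a) \<preceq> ?n b \<ominus> (?n b \<ominus> ?n c)"
      by (rule mns_mono_right)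
    then have "?n a \<preceq> ?n c"
      using inf_absorb[OF le(1)] inf_absorb[OF le(2)] eqv_sym le_eqv_trans eqv_le_trans by blast
    then show ?thesis by (simp add: one_mns_le_iff)
  qed
  have 4: "c \<preceq> b \<Longrightarrow> \<not> a \<preceq> b \<Longrightarrow> c \<preceq> a"
    using le_total le_trans by blast
  show ?thesis using assms(3) s 1 2 3 4 by (auto split: if_splits)
qed

text \<open>Both orders of addition represent the same value; the cases record whether
  \<open>b\<close> or \<open>c\<close> carries when it is added first.\<close>

lemma step_commute: "sle (step (step s b) c) (step (step s c) b)"
proof (cases s)
  case (Pair n a)
  let ?n = "\<lambda>x. one \<ominus> x"
  have I: "\<And>a b c. a \<ominus> b \<preceq> c \<longleftrightarrow> a \<ominus> c \<preceq> b"
    unfolding le_def by (rule Z_cong[OF mns_exchange])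
  \<comment> \<open>Both sides are 1 + a - b - c, cut off at 0.\<close>
  have swap: "?n b \<ominus> (c \<ominus> a) \<doteq> ?n c \<ominus> (b \<ominus> a)" if "a \<preceq> b" "a \<preceq> c" for b c
  proof -
    have "?n b \<ominus> (c \<ominus> a) \<doteq> ?n b \<ominus> (?n a \<ominus> ?n c)"
      by (rule eqv_mns_right[OF eqv_sym[OF mns_contra]])
    also have "\<dots> \<doteq> ?n c \<ominus> (?n a \<ominus> ?n b)"
      using that by (intro mns_le_swap) (simp_all add: one_mns_le_iff)
    also have "\<dots> \<doteq> ?n c \<ominus> (b \<ominus> a)"
      by (rule eqv_mns_right[OF mns_contra])
    finally show ?thesis .
  qed
  have flip: "c \<ominus> ?n x \<doteq> x \<ominus> ?n c" for c x
    using eqv_trans[OF eqv_mns_left[OF eqv_sym[OF mns_mns_one]] mns_contra] .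
  \<comment> \<open>Again both sides are 1 + a - b - c. On the left \<open>b\<close> is added first
    and carries; on the right \<open>c\<close> is added first without a carry.\<close>
  have mixed: "?n (b \<ominus> a) \<ominus> c \<doteq> ?n (b \<ominus> (a \<ominus> c))" if "a \<preceq> b" "c \<preceq> a" for b c
  proof -
    let ?t = "b \<ominus> (a \<ominus> c)"
    have "c \<preceq> ?t"
      using eqv_le_trans[OF eqv_sym[OF inf_absorb[OF that(2)]] mns_mono_left[OF that(1)]] .
    have "b \<ominus> a \<doteq> (b \<ominus> c) \<ominus> (a \<ominus> c)"
      by (rule eqv_sym[OF mns_mns_cancel[OF that(2,1)]])
    also have "\<dots> \<doteq> ?t \<ominus> c" by (rule mns_exchange)
    finally have *: "b \<ominus> a \<doteq> ?t \<ominus> c" .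
    have "?n (b \<ominus> a) \<ominus> c \<doteq> ?n c \<ominus> (b \<ominus> a)" by (rule mns_exchange)
    also have "\<dots> \<doteq> ?n c \<ominus> (?t \<ominus> c)" by (rule eqv_mns_right[OF *])
    also have "\<dots> \<doteq> ?n ?t" by (rule mns_mns_cancel[OF \<open>c \<preceq> ?t\<close> le_one])
    finally show ?thesis .
  qed
  \<comment> \<open>After a carry at \<open>b\<close>, adding some \<open>c\<close> strictly below
    \<open>a\<close> cannot carry again, because \<open>b\<close> is at most the unit.\<close>
  have nle: "\<not> ?n (b \<ominus> a) \<preceq> c" if "\<not> a \<preceq> c" for b c
  proof
    assume "?n (b \<ominus> a) \<preceq> c"
    then have "?n c \<preceq> b \<ominus> a" by (simp only: I)
    also have "b \<ominus> a \<preceq> ?n a" by (rule mns_mono_left[OF le_one])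
    finally show False using that by (simp add: one_mns_le_iff)
  qed
  consider "\<not> a \<preceq> b" "\<not> a \<preceq> c" | "a \<preceq> b" "a \<preceq> c" | "a \<preceq> b" "\<not> a \<preceq> c" | "\<not> a \<preceq> b" "a \<preceq> c"
    by blast
  then show ?thesis
  proof cases
    case 1
    then have le: "b \<preceq> a" "c \<preceq> a" using le_total by blast+
    show ?thesis
      using 1 Pair mns_le_swap[OF le] mns_exchange_le I[of a b c]
      by (auto simp: one_mns_le_iff eqv_def)
  next
    case 2
    have "?n (b \<ominus> a) \<preceq> c \<longleftrightarrow> ?n (c \<ominus> a) \<preceq> b"
    proof -
      have "?n (b \<ominus> a) \<preceq> c \<longleftrightarrow> ?n c \<preceq> b \<ominus> a" by (rule I)
      also have "\<dots> \<longleftrightarrow> ?n b \<preceq> c \<ominus> a"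
        using Z_cong[OF swap[OF 2]] by (simp add: le_def)
      also have "\<dots> \<longleftrightarrow> ?n (c \<ominus> a) \<preceq> b" by (rule I)
      finally show ?thesis .
    qed
    moreover have "?n (c \<ominus> a) \<ominus> b \<preceq> ?n (b \<ominus> a) \<ominus> c"
    proof -
      have "?n (c \<ominus> a) \<ominus> b \<doteq> ?n b \<ominus> (c \<ominus> a)" by (rule mns_exchange)
      also have "\<dots> \<doteq> ?n c \<ominus> (b \<ominus> a)" by (rule swap[OF 2])
      also have "\<dots> \<doteq> ?n (b \<ominus> a) \<ominus> c" by (rule mns_exchange)
      finally show ?thesis by (simp add: eqv_def)
    qed
    moreover have "c \<ominus> ?n (b \<ominus> a) \<preceq> b \<ominus> ?n (c \<ominus> a)"
    proof -
      have "c \<ominus> ?n (b \<ominus> a) \<doteq> (b \<ominus> a) \<ominus> ?n c" by (rule flip)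
      also have "\<dots> \<doteq> (b \<ominus> ?n c) \<ominus> a" by (rule mns_exchange)
      also have "\<dots> \<doteq> (c \<ominus> ?n b) \<ominus> a" by (rule eqv_mns_left[OF flip])
      also have "\<dots> \<doteq> (c \<ominus> a) \<ominus> ?n b" by (rule mns_exchange)
      also have "\<dots> \<doteq> b \<ominus> ?n (c \<ominus> a)" by (rule flip)
      finally show ?thesis by (simp add: eqv_def)
    qed
    ultimately show ?thesis using 2 Pair by (auto simp: one_mns_le_iff)
  next
    case 3
    then have "c \<preceq> a" "a \<ominus> c \<preceq> b" using le_total le_trans[OF mns_le] by blast+
    then show ?thesis using 3 Pair mixed[of b c] nle[of c b] by (auto simp: eqv_def)
  next
    case 4
    then have "b \<preceq> a" "a \<ominus> b \<preceq> c" using le_total le_trans[OF mns_le] by blast+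
    then show ?thesis using 4 Pair mixed[of c b] nle[of b c] by (auto simp: eqv_def)
  qed
qed

text \<open>The start value \<open>(0, one)\<close> stands for 0 + 1 - 1 = 0.\<close>

primrec total_sum :: "'a list \<Rightarrow> nat \<times> 'a" where
  "total_sum [] = (0, one)"
| "total_sum (b # xs) = step (total_sum xs) b"

lemma proper_total_sum: "proper (total_sum xs)"
proof (induction xs)
  case Nil
  show ?case by (simp add: proper_def not_Z_one)
qed (simp add: proper_step)

lemma total_sum_move:
  "sle (total_sum (us @ x # vs)) (total_sum (x # us @ vs)) \<and>
   sle (total_sum (x # us @ vs)) (total_sum (us @ x # vs))"
proof (induction us)
  case Nil
  show ?case by (simp add: sle_refl)
next
  case (Cons u us)
  then show ?case using step_commute sle_trans step_mono by simp blast
qed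

lemma total_sum_perm:
  "mset xs = mset ys \<Longrightarrow> sle (total_sum xs) (total_sum ys)"
proof (induction xs arbitrary: ys)
  case Nil
  then show ?case by (simp add: sle_refl)
next
  case (Cons x xs)
  obtain us vs where ys: "ys = us @ x # vs"
    using Cons.prems by (metis in_set_conv_decomp list.set_intros(1) mset_eq_setD)
  then have "sle (total_sum xs) (total_sum (us @ vs))"
    using Cons by simp
  then have "sle (total_sum (x # xs)) (total_sum (x # us @ vs))"
    by (simp add: step_mono)
  then show ?case using total_sum_move sle_trans ys by blast
qed

section \<open>The induced preorder on multisets\<close>

text \<open>Sums do not depend on the order of the entries, so any listing may be used. Multisets
  are the free commutative monoid; with cancellation the preorder extends to formal
  differences.\<close>

definition mle :: "'a multiset \<Rightarrow> 'a multiset \<Rightarrow> bool" where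
  "mle M N \<longleftrightarrow> (\<exists>xs ys. mset xs = M \<and> mset ys = N \<and> sle (total_sum xs) (total_sum ys))"

lemma mle_mset: "mle (mset xs) (mset ys) \<longleftrightarrow> sle (total_sum xs) (total_sum ys)"
proof
  assume "mle (mset xs) (mset ys)"
  then obtain xs' ys' where *: "mset xs' = mset xs" "mset ys' = mset ys"
      "sle (total_sum xs') (total_sum ys')"
    by (auto simp: mle_def)
  show "sle (total_sum xs) (total_sum ys)"
    using sle_trans[OF sle_trans[OF total_sum_perm[OF *(1)[symmetric]] *(3)] total_sum_perm[OF *(2)]] .
qed (auto simp: mle_def)

lemma mle_refl: "mle M M"
proof -
  obtain xs where "mset xs = M" using ex_mset by blast
  then show ?thesis using mle_mset[of xs xs] sle_refl by simp
qed

lemma mle_trans [trans]: "mle M N \<Longrightarrow> mle N K \<Longrightarrow> mle M K"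
proof -
  obtain xs ys zs where "mset xs = M" "mset ys = N" "mset zs = K" using ex_mset by metis
  then show "mle M N \<Longrightarrow> mle N K \<Longrightarrow> mle M K"
    using mle_mset[of xs ys] mle_mset[of ys zs] mle_mset[of xs zs]
      sle_trans[of "total_sum xs" "total_sum ys" "total_sum zs"] by simp
qed

lemma mle_total: "mle M N \<or> mle N M"
proof -
  obtain xs ys where "mset xs = M" "mset ys = N" using ex_mset by metis
  then show ?thesis
    using mle_mset[of xs ys] mle_mset[of ys xs] sle_total[of "total_sum xs" "total_sum ys"] by simp
qed

lemma mle_add_mset: "mle (add_mset b M) (add_mset b N) \<longleftrightarrow> mle M N"
proof -
  obtain xs ys where "M = mset xs" "N = mset ys" using ex_mset by metis
  then show ?thesis
    using mle_mset[of "b # xs" "b # ys"] mle_mset[of xs ys]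
      step_mono[of "total_sum xs" "total_sum ys" b]
      step_strict_mono[OF proper_total_sum proper_total_sum, of xs b ys] by auto
qed

lemma mle_add_right: "mle (M + K) (N + K) \<longleftrightarrow> mle M N"
  by (induction K) (simp_all add: mle_add_mset)

lemma mle_add: "mle M N \<Longrightarrow> mle M' N' \<Longrightarrow> mle (M + M') (N + N')"
  using mle_trans[of "M + M'" "N + M'" "N + N'"] mle_add_right[of M M' N]
    mle_add_right[of M' N N'] by (simp add: add.commute)

lemma mle_empty: "mle {#} M"
proof -
  have "mle {#} {#b#}" for b
    using mle_mset[of "[]" "[b]"] by (auto simp: mns_le)
  then show ?thesis
  proof (induction M)
    case empty
    show ?case by (rule mle_refl)
  next
    case (add x M)
    then show ?case using mle_add[of "{#}" M "{#}" "{#x#}"] by simp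
  qed
qed

lemma mle_single_empty: "mle {#x#} {#} \<longleftrightarrow> Z x"
proof -
  have "one \<preceq> x \<Longrightarrow> \<not> Z x" using not_Z_one Z_le by blast
  moreover have "one \<preceq> one \<ominus> x \<longleftrightarrow> Z x"
    unfolding le_def by (rule Z_cong[OF mns_mns_one])
  ultimately show ?thesis using mle_mset[of "[x]" "[]"] by auto
qed

lemma mle_single: "mle {#x#} {#y#} \<longleftrightarrow> x \<preceq> y"
proof -
  have "one \<preceq> y \<Longrightarrow> x \<preceq> y" using le_one le_trans by blast
  moreover have "y \<ominus> one \<preceq> z \<and> x \<ominus> one \<preceq> z" for z
    by (simp add: Z_imp_le Z_mns_one)
  moreover have "one \<preceq> x \<Longrightarrow> x \<preceq> y \<Longrightarrow> one \<preceq> y" using le_trans by blast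
  ultimately show ?thesis
    using mle_mset[of "[x]" "[y]"] by (auto simp: one_mns_le_iff)
qed

text \<open>Truncated difference becomes subtraction in the group whenever nothing is cut
  off.\<close>

lemma mle_mns:
  assumes "a \<preceq> b"
  shows "mle {#b \<ominus> a, a#} {#b#}" "mle {#b#} {#b \<ominus> a, a#}"
proof -
  have Z: "Z (x \<ominus> one)" for x by (rule Z_mns_one)
  have "sle (total_sum [b \<ominus> a, a]) (total_sum [b]) \<and> sle (total_sum [b]) (total_sum [b \<ominus> a, a])"
  \<comment> \<open>Adding \<open>a\<close> to zero carries exactly when \<open>a\<close> is the
    unit up to equivalence. Otherwise the second addition carries exactly when \<open>b\<close> is
    the unit, as in the sum of \<open>b\<close> alone.\<close>
  proof (cases "one \<preceq> a")
    case True
    have b: "one \<preceq> b" using True assms le_trans by blast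
    let ?a = "one \<ominus> (a \<ominus> one)"
    have a: "?a \<doteq> one" and b1: "one \<ominus> (b \<ominus> one) \<doteq> one" by (simp_all add: mns_Z Z)
    have za: "Z (b \<ominus> a)" using le_trans[OF le_one True] by (simp add: le_def)
    have "\<not> ?a \<preceq> b \<ominus> a" using za Z_le Z_cong[OF a] not_Z_one by blast
    moreover have "?a \<ominus> (b \<ominus> a) \<doteq> one \<ominus> (b \<ominus> one)"
      using eqv_trans[OF eqv_trans[OF mns_Z[OF za] a] eqv_sym[OF b1]] .
    ultimately show ?thesis using True b by (auto simp: eqv_def)
  next
    case False
    have c: "(one \<ominus> a) \<ominus> (b \<ominus> a) \<doteq> one \<ominus> b"
      by (rule mns_mns_cancel[OF assms le_one])
    have iff: "one \<ominus> a \<preceq> b \<ominus> a \<longleftrightarrow> one \<preceq> b"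
      unfolding le_def by (rule Z_cong[OF c])
    have "Z ((b \<ominus> a) \<ominus> (one \<ominus> a))"
      using mns_mono_left[OF le_one] by (simp add: le_def)
    then have "(b \<ominus> a) \<ominus> (one \<ominus> a) \<preceq> z" "b \<ominus> one \<preceq> z" for z
      by (simp_all add: Z_imp_le Z)
    then show ?thesis using False c iff by (auto simp: one_mns_le_iff eqv_def)
  qed
  then show "mle {#b \<ominus> a, a#} {#b#}" "mle {#b#} {#b \<ominus> a, a#}"
    using mle_mset[of "[b \<ominus> a, a]" "[b]"] mle_mset[of "[b]" "[b \<ominus> a, a]"] by auto
qed

end

section \<open>Derivability and prime theories\<close>

text \<open>The language has no constant for falsity; the negation of an identity in an arbitrary
  variable takes its place. As a deficit it is the unit.\<close>

definition bot_form :: "'v form" where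
  "bot_form = Neg (Var undefined \<^bold>\<rightarrow> Var undefined)"

text \<open>Here \<open>A4\<close> enters: contraposition makes falsity imply everything and makes
  \<open>Neg A\<close> equivalent to implying falsity.\<close>

lemma
  fixes T :: "'v form set" and A :: "'v form"
  shows derives_bot: "T \<turnstile> bot_form \<^bold>\<rightarrow> A"
    and derives_Neg: "T \<turnstile> Neg A \<^bold>\<rightarrow> A \<^bold>\<rightarrow> bot_form"
    and derives_imp_bot: "T \<turnstile> (A \<^bold>\<rightarrow> bot_form) \<^bold>\<rightarrow> Neg A"
proof -
  have syl: "T \<turnstile> A \<^bold>\<rightarrow> B \<Longrightarrow> T \<turnstile> B \<^bold>\<rightarrow> C \<Longrightarrow> T \<turnstile> A \<^bold>\<rightarrow> C" for A B C :: "'v form"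
    using mp[OF _ mp[OF _ ax[OF A2]]] .
  have cp: "T \<turnstile> A \<^bold>\<rightarrow> Neg B \<^bold>\<rightarrow> Neg C \<Longrightarrow> T \<turnstile> A \<^bold>\<rightarrow> C \<^bold>\<rightarrow> B" for A B C :: "'v form"
    using syl[OF _ ax[OF A4]] .
  have assertion: "T \<turnstile> A \<^bold>\<rightarrow> (A \<^bold>\<rightarrow> B) \<^bold>\<rightarrow> B" for A B :: "'v form"
    using syl[OF ax[OF A1] ax[OF A3]] .
  define top where "top = (Var undefined \<^bold>\<rightarrow> Var undefined :: 'v form)"
  have bot: "bot_form = Neg top" by (simp add: bot_form_def top_def)
  have top: "T \<turnstile> top"
    unfolding top_def
  proof -
    \<comment> \<open>The identity comes from the axiom \<open>?t\<close>: \<open>assertion\<close>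
      gives that \<open>?t\<close> implying \<open>?v\<close> implies \<open>?v\<close>, and an
      instance of \<open>A1\<close> supplies the premise from \<open>?v\<close>.\<close>
    let ?v = "Var undefined :: 'v form"
      and ?t = "Var undefined \<^bold>\<rightarrow> Var undefined \<^bold>\<rightarrow> Var undefined :: 'v form"
    have "T \<turnstile> ?t" by (rule ax[OF A1])
    then have "T \<turnstile> (?t \<^bold>\<rightarrow> ?v) \<^bold>\<rightarrow> ?v" using assertion mp by blast
    then show "T \<turnstile> ?v \<^bold>\<rightarrow> ?v" using syl[OF ax[OF A1]] by blast
  qed
  have drop: "T \<turnstile> A \<^bold>\<rightarrow> top \<^bold>\<rightarrow> B \<Longrightarrow> T \<turnstile> A \<^bold>\<rightarrow> B" for A B :: "'v form"
    using syl mp[OF top assertion] by blast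
  show bot_le: "T \<turnstile> bot_form \<^bold>\<rightarrow> A" for A :: "'v form"
    unfolding bot by (rule drop[OF cp[OF ax[OF A1]]])
  show Neg: "T \<turnstile> Neg A \<^bold>\<rightarrow> A \<^bold>\<rightarrow> bot_form" for A :: "'v form"
    by (rule cp[OF ax[OF A1]])
  have dn: "T \<turnstile> Neg (Neg A) \<^bold>\<rightarrow> A" for A :: "'v form"
    by (rule drop[OF cp[OF Neg[of "Neg A", unfolded bot]]])
  have "T \<turnstile> (A \<^bold>\<rightarrow> bot_form) \<^bold>\<rightarrow> Neg (Neg A) \<^bold>\<rightarrow> Neg top"
    unfolding bot by (rule mp[OF dn ax[OF A2]])
  then show "T \<turnstile> (A \<^bold>\<rightarrow> bot_form) \<^bold>\<rightarrow> Neg A"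
    by (rule drop[OF cp])
qed

text \<open>The algebra is that of the deficits \<open>1 - \<phi>\<close>: implication reversed is truncated difference,
  and derivability is vanishing.\<close>

interpretation luk: bounded_bck "\<lambda>A B. B \<^bold>\<rightarrow> A" "derives T" bot_form for T
proof
  show "T \<turnstile> x \<Longrightarrow> T \<turnstile> x \<^bold>\<rightarrow> y \<Longrightarrow> T \<turnstile> y" for x y by (rule mp)
qed (rule derives_bot ax luk_axiom.intros)+

section \<open>Disjunction and prime extensions\<close>

abbreviation disj :: "'v form \<Rightarrow> 'v form \<Rightarrow> 'v form" where
  "disj A B \<equiv> (A \<^bold>\<rightarrow> B) \<^bold>\<rightarrow> B"

text \<open>Induction on the derivation replaces the deduction theorem, which in this logic holds
  only with powers of the added premise. For modus ponens, the bound on \<open>q\<close> is pushed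
  through \<open>A\<close> and then, by \<open>A2\<close>, to \<open>B\<close>.\<close>

lemma derives_disj_insert:
  assumes "insert p T \<turnstile> C" "T \<turnstile> disj p q"
  shows "T \<turnstile> disj C q"
  using assms(1)
proof induction
  case (ax A)
  then show ?case using luk.Z_le[OF luk.inf_le] derives.ax by metis
next
  case (hyp A)
  then show ?case using assms(2) luk.Z_le[OF luk.inf_le] derives.hyp by (metis insertE)
next
  case (mp A B)
  let ?le = "luk.le T"
  have "?le q (A \<^bold>\<rightarrow> q)" "?le q ((A \<^bold>\<rightarrow> B) \<^bold>\<rightarrow> q)"
    using mp.IH by (simp_all add: luk.le_def)
  have "?le q ((A \<^bold>\<rightarrow> B) \<^bold>\<rightarrow> q)" by fact
  also have "?le \<dots> ((A \<^bold>\<rightarrow> B) \<^bold>\<rightarrow> (A \<^bold>\<rightarrow> q))"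
    by (rule luk.mns_mono_left) fact
  also have "?le \<dots> (B \<^bold>\<rightarrow> q)"
    using luk.Z_le[OF luk.mns_exchange_le luk.Z_mns_anti] by (simp add: luk.le_def)
  finally show ?case by (simp add: luk.le_def)
qed

lemma derives_chain_Union:
  assumes "\<Union>C \<turnstile> A" "subset.chain UNIV C" "C \<noteq> {}"
  shows "\<exists>T\<in>C. T \<turnstile> A"
  using assms(1)
proof induction
  case (ax A)
  then show ?case using assms(3) derives.ax by blast
next
  case (hyp A)
  then show ?case using derives.hyp by blast
next
  case (mp A B)
  then obtain T T' where T: "T \<in> C" "T' \<in> C" "T \<turnstile> A" "T' \<turnstile> A \<^bold>\<rightarrow> B" by blast
  have mono: "S \<subseteq> S' \<Longrightarrow> S \<turnstile> F \<Longrightarrow> S' \<turnstile> F" for S S' :: "'a form set" and F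
  proof -
    assume "S \<turnstile> F" "S \<subseteq> S'" then show "S' \<turnstile> F"
      by induction (auto intro: derives.intros)
  qed
  have "T \<subseteq> T' \<or> T' \<subseteq> T"
    using assms(2) T by (auto simp: subset_chain_def)
  then show ?case using T mono derives.mp by meson
qed

text \<open>If a maximal theory proved neither implication, adding either one would prove
  \<open>\<psi>\<close>. Applying \<open>derives_disj_insert\<close> twice to the prelinear
  disjunction replaces each disjunct by \<open>\<psi>\<close>.\<close>

lemma ex_prime_extension:
  assumes "\<not> \<Theta> \<turnstile> \<psi>"
  obtains T where "\<Theta> \<subseteq> T" "\<not> T \<turnstile> \<psi>" "\<And>A B. T \<turnstile> A \<^bold>\<rightarrow> B \<or> T \<turnstile> B \<^bold>\<rightarrow> A"
proof -
  define \<A> where "\<A> = {T. \<Theta> \<subseteq> T \<and> \<not> T \<turnstile> \<psi>}"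
  have "\<exists>M\<in>\<A>. \<forall>X\<in>\<A>. M \<subseteq> X \<longrightarrow> X = M"
  proof (rule subset_Zorn_nonempty)
    show "\<A> \<noteq> {}" using assms by (auto simp: \<A>_def)
  next
    fix C assume "C \<noteq> {}" "subset.chain \<A> C"
    then have "subset.chain UNIV C" "C \<subseteq> \<A>" by (auto simp: subset_chain_def)
    then show "\<Union>C \<in> \<A>"
      using derives_chain_Union[of C \<psi>] \<open>C \<noteq> {}\<close> unfolding \<A>_def by blast
  qed
  then obtain T where T: "T \<in> \<A>" and max: "\<And>X. X \<in> \<A> \<Longrightarrow> T \<subseteq> X \<Longrightarrow> X = T" by blast
  have ext: "T \<turnstile> p \<or> insert p T \<turnstile> \<psi>" for p
    using max[of "insert p T"] T hyp[of p T] unfolding \<A>_def by blast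
  have "T \<turnstile> A \<^bold>\<rightarrow> B \<or> T \<turnstile> B \<^bold>\<rightarrow> A" for A B
  proof (rule ccontr)
    assume "\<not> ?thesis"
    then have *: "insert (A \<^bold>\<rightarrow> B) T \<turnstile> \<psi>" "insert (B \<^bold>\<rightarrow> A) T \<turnstile> \<psi>" using ext by blast+
    have "T \<turnstile> disj \<psi> (B \<^bold>\<rightarrow> A)"
      by (rule derives_disj_insert[OF *(1) luk.prelinearity])
    then have "T \<turnstile> disj (B \<^bold>\<rightarrow> A) \<psi>"
      using luk.Z_mp[OF _ luk.Z_inf_commute] by blast
    then have "T \<turnstile> disj \<psi> \<psi>"
      by (rule derives_disj_insert[OF *(2)])
    then have "T \<turnstile> \<psi>"
      using luk.Z_mp[OF luk.le_refl[unfolded luk.le_def]] by blast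
    then show False using T by (simp add: \<A>_def)
  qed
  then show ?thesis using that T by (auto simp: \<A>_def)
qed

section \<open>Preorders on groups of integer points\<close>

text \<open>The lattice is kept inside Euclidean space so that inner products and separation of
  convex sets apply.\<close>

definition int_points :: "'a::euclidean_space set" where
  "int_points = {z. \<forall>b\<in>Basis. z \<bullet> b \<in> \<int>}"

lemma int_points_sum_scaleR:
  "(\<And>v. v \<in> S \<Longrightarrow> v \<in> int_points) \<Longrightarrow> (\<Sum>v\<in>S. of_int (k v) *\<^sub>R v) \<in> int_points"
  by (simp add: int_points_def inner_sum_left Ints_sum)

lemma int_points_norm_less_1:
  assumes "z \<in> int_points" "norm z < 1"
  shows "z = 0"
proof (rule euclidean_eqI)
  fix b :: 'a assume b: "b \<in> Basis"
  have "\<bar>z \<bullet> b\<bar> < 1" using Basis_le_norm[OF b, of z] assms(2) by simp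
  moreover have "z \<bullet> b \<in> \<int>" using assms(1) b by (simp add: int_points_def)
  ultimately show "z \<bullet> b = 0 \<bullet> b" by (auto elim!: Ints_cases)
qed

text \<open>\<open>P\<close> is the nonnegative part of a total preorder; a point and its negative
  may both lie in it. \<open>L\<close> is a subgroup, not the full lattice, because the induction
  below intersects it with hyperplanes.\<close>

locale int_group_preorder =
  fixes L P :: "'a::euclidean_space set"
  assumes L_int: "L \<subseteq> int_points"
    and L_0: "0 \<in> L" and L_diff: "x \<in> L \<Longrightarrow> y \<in> L \<Longrightarrow> x - y \<in> L"
    and P_add: "x \<in> P \<Longrightarrow> y \<in> P \<Longrightarrow> x + y \<in> P"
    and P_total: "x \<in> L \<Longrightarrow> x \<in> P \<or> - x \<in> P"
begin

lemma L_minus: "x \<in> L \<Longrightarrow> - x \<in> L"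
  using L_diff[OF L_0] by simp

lemma L_add: "x \<in> L \<Longrightarrow> y \<in> L \<Longrightarrow> x + y \<in> L"
  using L_diff[OF _ L_minus] by fastforce

lemma L_scaleR_nat: "x \<in> L \<Longrightarrow> real n *\<^sub>R x \<in> L"
  by (induction n) (auto simp: L_0 algebra_simps intro: L_add)

lemma P_0: "0 \<in> P"
  using P_total[OF L_0] by simp

lemma P_scaleR_nat: "x \<in> P \<Longrightarrow> real n *\<^sub>R x \<in> P"
  by (induction n) (auto simp: P_0 algebra_simps intro: P_add)

lemma neg_add:
  assumes "x \<in> L - P" "y \<in> L - P"
  shows "x + y \<in> L - P"
proof -
  have "- y \<in> P" using assms P_total by blast
  then have "x + y \<notin> P" using P_add[of "x + y" "- y"] assms by auto
  then show ?thesis using assms L_add by blast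
qed

lemma neg_scaleR:
  assumes "x \<in> L - P" "k > 0"
  shows "of_int k *\<^sub>R x \<in> L - P"
proof -
  have "real (Suc n) *\<^sub>R x \<in> L - P" for n
  proof (induction n)
    case (Suc n)
    have "real (Suc (Suc n)) *\<^sub>R x = (real (Suc n) + 1) *\<^sub>R x" by simp
    also have "\<dots> = real (Suc n) *\<^sub>R x + x" by (simp only: scaleR_add_left scaleR_one)
    finally have "real (Suc (Suc n)) *\<^sub>R x = real (Suc n) *\<^sub>R x + x" .
    then show ?case using neg_add[OF Suc assms(1)] by simp
  qed (use assms in simp)
  from this[of "nat k - 1"] show ?thesis using assms(2) by simp
qed

lemma neg_sum:
  assumes "finite S" "S \<noteq> {}" "\<And>v. v \<in> S \<Longrightarrow> f v \<in> L - P"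
  shows "sum f S \<in> L - P"
  using assms
proof (induction rule: finite_ne_induct)
  case (insert x F)
  then show ?case using neg_add[of "f x" "sum f F"] by simp
qed simp

text \<open>A real convex combination of negative integer points that vanishes can be approximated
  simultaneously by an integer combination with positive coefficients; being a short integer
  point, that combination vanishes as well, although it is negative.\<close>

lemma zero_notin_convex_hull_neg: "0 \<notin> convex hull (L - P)"
proof
  assume "0 \<in> convex hull (L - P)"
  then obtain S0 u where S0: "finite S0" "S0 \<subseteq> L - P" "\<forall>x\<in>S0. 0 \<le> u x" "sum u S0 = 1"
      "(\<Sum>v\<in>S0. u v *\<^sub>R v) = 0"
    unfolding convex_hull_explicit by blast
  \<comment> \<open>Zero coefficients are dropped, since an integer approximating zero need not be
    positive.\<close>
  define S where "S = {v \<in> S0. u v > 0}"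
  have S: "finite S" "S \<subseteq> L - P" and u: "\<And>v. v \<in> S \<Longrightarrow> u v > 0"
    using S0 by (auto simp: S_def)
  have "(\<Sum>v\<in>S. u v *\<^sub>R v) = (\<Sum>v\<in>S0. u v *\<^sub>R v)"
    using S0 by (intro sum.mono_neutral_left) (auto simp: S_def)
  then have 0: "(\<Sum>v\<in>S. u v *\<^sub>R v) = 0" using S0 by simp
  have "sum u S = sum u S0"
    using S0 by (intro sum.mono_neutral_left) (auto simp: S_def)
  then have ne: "S \<noteq> {}" using S0 by auto
  \<comment> \<open>Above this bound, 1 / N is smaller than every coefficient, so the approximating
    integers are positive, and the error of the combination has norm below 1.\<close>
  define B where "B = (\<Sum>v\<in>S. norm v) + (\<Sum>v\<in>S. 1 / u v)"
  obtain N :: nat where N: "real N > B" using reals_Archimedean2 by blast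
  have nonneg: "(\<Sum>v\<in>S. norm v) \<ge> 0" "(\<Sum>v\<in>S. 1 / u v) \<ge> 0"
    using u by (auto intro!: sum_nonneg divide_nonneg_pos)
  have N0: "N > 0" using N nonneg by (cases N) (auto simp: B_def)
  have Nu: "1 / real N < u v" if "v \<in> S" for v
  proof -
    have "1 / u v \<le> (\<Sum>v\<in>S. 1 / u v)"
      using S u that by (intro member_le_sum) (auto simp: less_imp_le)
    then have "1 / u v < real N" using N nonneg by (simp add: B_def)
    then show ?thesis using u[OF that] N0 by (simp add: field_simps)
  qed
  obtain h where h: "bij_betw h {0..<card S} S"
    using ex_bij_betw_nat_finite[OF S(1)] by blast
  obtain q p where q: "q > 0"
    and qp: "\<And>i. i < card S \<Longrightarrow> \<bar>of_int q * u (h i) - of_int (p i)\<bar> < 1 / real N"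
    using Dirichlet_approx_simult[OF N0, of "card S" "\<lambda>i. u (h i)"] by metis
  define k where "k v = p (inv_into {0..<card S} h v)" for v
  have k: "\<bar>of_int q * u v - of_int (k v)\<bar> < 1 / real N" if "v \<in> S" for v
  proof -
    have "inv_into {0..<card S} h v < card S"
      using bij_betw_apply[OF bij_betw_inv_into[OF h] that] by simp
    then show ?thesis
      using qp[of "inv_into {0..<card S} h v"] bij_betw_inv_into_right[OF h that] by (simp add: k_def)
  qed
  have kpos: "k v > 0" if "v \<in> S" for v
  proof -
    have "u v \<le> of_int q * u v" using q u[OF that] by simp
    then have "of_int (k v) > (0::real)" using k[OF that] Nu[OF that] by linarith
    then show ?thesis by simp
  qed
  define y where "y = (\<Sum>v\<in>S. of_int (k v) *\<^sub>R v)"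
  have "y = y - of_int q *\<^sub>R (\<Sum>v\<in>S. u v *\<^sub>R v)" using 0 by simp
  also have "\<dots> = (\<Sum>v\<in>S. (of_int (k v) - of_int q * u v) *\<^sub>R v)"
    by (simp add: y_def scaleR_sum_right sum_subtractf scaleR_diff_left)
  finally have y: "y = (\<Sum>v\<in>S. (of_int (k v) - of_int q * u v) *\<^sub>R v)" .
  have "norm y \<le> (\<Sum>v\<in>S. 1 / real N * norm v)"
    unfolding y
  proof (intro sum_norm_le)
    fix v assume "v \<in> S"
    then show "norm ((of_int (k v) - of_int q * u v) *\<^sub>R v) \<le> 1 / real N * norm v"
      using k[of v] unfolding norm_scaleR by (intro mult_right_mono) auto
  qed
  also have "\<dots> = (\<Sum>v\<in>S. norm v) / real N"
    by (simp add: sum_divide_distrib)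
  also have "\<dots> < 1" using N N0 nonneg by (simp add: B_def)
  finally have "y = 0"
    using S L_int int_points_norm_less_1 int_points_sum_scaleR[of S k] unfolding y_def by blast
  moreover have "y \<in> L - P"
    unfolding y_def using S kpos neg_scaleR ne by (intro neg_sum) auto
  ultimately show False using P_0 by simp
qed

text \<open>The functional is minus the normal of a hyperplane separating the negative elements from
  the origin. Membership in the span of \<open>L\<close> is what later makes the dimension
  drop.\<close>

lemma ex_first_functional:
  assumes "\<not> L \<subseteq> P"
  obtains w where "w \<in> span L" "w \<noteq> 0"
    "\<And>z. z \<in> L \<Longrightarrow> w \<bullet> z > 0 \<Longrightarrow> z \<in> P" "\<And>z. z \<in> L \<Longrightarrow> w \<bullet> z < 0 \<Longrightarrow> z \<notin> P"
proof -
  have "convex hull (L - P) \<noteq> {}" using assms by auto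
  then obtain a where a: "a \<in> span (convex hull (L - P))" "a \<noteq> 0"
      "\<And>x. x \<in> convex hull (L - P) \<Longrightarrow> 0 \<le> a \<bullet> x"
    using separating_hyperplane_set_0_inspan[OF convex_convex_hull _ zero_notin_convex_hull_neg] by blast
  have neg: "0 \<le> a \<bullet> x" if "x \<in> L - P" for x
    using a(3) that hull_inc by metis
  have "convex hull (L - P) \<subseteq> span L"
    by (intro hull_minimal) (auto intro: span_base subspace_imp_convex subspace_span)
  then have aL: "- a \<in> span L"
    using a(1) span_mono span_span span_neg by blast
  obtain z0 where z0: "z0 \<in> L - P" using assms by blast
  show ?thesis
  proof
    show "- a \<in> span L" "- a \<noteq> 0" using aL a by auto
    show "z \<in> P" if "z \<in> L" "- a \<bullet> z > 0" for z
      using neg[of z] that by auto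
    show "z \<notin> P" if "z \<in> L" "- a \<bullet> z < 0" for z
    proof
      assume "z \<in> P"
      have "- z \<in> P" using neg[of "- z"] that L_minus[of z] by auto
      \<comment> \<open>Subtracting any multiple of a point of \<open>P\<close> from the negative
        element \<open>z0\<close> leaves it negative. For large multiples this violates the sign
        condition on \<open>a\<close>.\<close>
      have "z0 - real n *\<^sub>R z \<in> L - P" for n
      proof -
        have "z0 - real n *\<^sub>R z \<notin> P"
          using P_add[OF _ P_scaleR_nat[OF \<open>z \<in> P\<close>, of n], of "z0 - real n *\<^sub>R z"] z0 by auto
        then show ?thesis using z0 L_diff L_scaleR_nat that by auto
      qed
      then have "real n * (a \<bullet> z) \<le> a \<bullet> z0" for n
        using neg[of "z0 - real n *\<^sub>R z"] by (simp add: inner_diff_right)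
      moreover have "a \<bullet> z > 0" using that by simp
      then obtain n where "real n * (a \<bullet> z) > a \<bullet> z0" using reals_Archimedean3 by blast
      ultimately show False by (meson not_le)
    qed
  qed
qed

end

section \<open>Lexicographic representation\<close>

primrec lex_nonneg :: "real list \<Rightarrow> bool" where
  "lex_nonneg [] \<longleftrightarrow> True"
| "lex_nonneg (c # cs) \<longleftrightarrow> c > 0 \<or> c = 0 \<and> lex_nonneg cs"

text \<open>Induction on the dimension: the first functional decides all points off its kernel. The
  points in the kernel form such a group again, and vectors chosen inside the kernel are orthogonal
  to the first one.\<close>

lemma ex_lexicographic_representation:
  fixes L P V :: "'a::euclidean_space set"
  assumes "int_group_preorder L P" "subspace V" "L \<subseteq> V"
  shows "\<exists>ws. set ws \<subseteq> V \<and> length ws \<le> dim V \<and> (\<forall>w\<in>set ws. norm w = 1) \<and>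
    sorted_wrt orthogonal ws \<and> (\<forall>z\<in>L. z \<in> P \<longleftrightarrow> lex_nonneg (map (\<lambda>w. w \<bullet> z) ws))"
  using assms
proof (induction "dim V" arbitrary: L P V rule: less_induct)
  case less
  interpret int_group_preorder L P by fact
  show ?case
  proof (cases "L \<subseteq> P")
    case True
    then show ?thesis by (intro exI[of _ "[]"]) auto
  next
    case False
    then obtain w0 where w0: "w0 \<in> span L" "w0 \<noteq> 0"
      "\<And>z. z \<in> L \<Longrightarrow> w0 \<bullet> z > 0 \<Longrightarrow> z \<in> P" "\<And>z. z \<in> L \<Longrightarrow> w0 \<bullet> z < 0 \<Longrightarrow> z \<notin> P"
      by (rule ex_first_functional) blast
    define w where "w = (1 / norm w0) *\<^sub>R w0"
    have w: "norm w = 1" "w \<in> V" "\<And>z. z \<in> L \<Longrightarrow> w \<bullet> z > 0 \<Longrightarrow> z \<in> P"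
      "\<And>z. z \<in> L \<Longrightarrow> w \<bullet> z < 0 \<Longrightarrow> z \<notin> P"
      using w0 span_minimal[OF less.prems(3,2)] subspace_scale[OF less.prems(2)]
      by (auto simp: w_def zero_less_divide_iff divide_less_0_iff)
    define V' where "V' = V \<inter> {x. w \<bullet> x = 0}"
    have V': "subspace V'"
      unfolding V'_def by (intro subspace_inter less.prems(2) subspace_hyperplane)
    have "w \<bullet> w = 1" using w(1) by (simp add: norm_eq_1)
    then have "w \<notin> V'" by (simp add: V'_def)
    moreover have "V' \<subseteq> V" by (simp add: V'_def)
    ultimately have "V' \<subset> V" using w(2) by blast
    then have dim: "dim V' < dim V"
      using V' less.prems(2) by (intro dim_psubset) (simp add: span_eq_iff[THEN iffD2])
    have "int_group_preorder (L \<inter> V') (P \<inter> V')"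
    proof
      show "L \<inter> V' \<subseteq> int_points" using L_int by auto
      show "0 \<in> L \<inter> V'" using L_0 V' subspace_0 by auto
      show "x - y \<in> L \<inter> V'" if "x \<in> L \<inter> V'" "y \<in> L \<inter> V'" for x y
        using that L_diff subspace_diff[OF V'] by auto
      show "x + y \<in> P \<inter> V'" if "x \<in> P \<inter> V'" "y \<in> P \<inter> V'" for x y
        using that P_add subspace_add[OF V'] by auto
      show "x \<in> P \<inter> V' \<or> - x \<in> P \<inter> V'" if "x \<in> L \<inter> V'" for x
        using that P_total subspace_neg[OF V'] by auto
    qed
    then obtain ws where ws: "set ws \<subseteq> V'" "length ws \<le> dim V'" "\<forall>w\<in>set ws. norm w = 1"
      "sorted_wrt orthogonal ws"
      "\<forall>z\<in>L \<inter> V'. z \<in> P \<inter> V' \<longleftrightarrow> lex_nonneg (map (\<lambda>w. w \<bullet> z) ws)"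
      using less.hyps[OF dim _ V'] by blast
    have "z \<in> P \<longleftrightarrow> lex_nonneg (map (\<lambda>w. w \<bullet> z) (w # ws))" if "z \<in> L" for z
    proof (cases "w \<bullet> z = 0")
      case True
      then have "z \<in> V'" using that less.prems(3) by (auto simp: V'_def)
      then show ?thesis using True ws(5) that by simp
    next
      case False
      then consider "w \<bullet> z > 0" | "w \<bullet> z < 0" by linarith
      then show ?thesis by cases (use w that in auto)
    qed
    moreover have "\<forall>v\<in>set ws. orthogonal w v"
      using ws(1) by (auto simp: V'_def orthogonal_def)
    moreover have "set (w # ws) \<subseteq> V" using ws(1) w(2) by (auto simp: V'_def)
    moreover have "length (w # ws) \<le> dim V" using dim ws(2) by simp
    ultimately show ?thesis
      using ws(3,4) w(1) by (intro exI[of _ "w # ws"]) auto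
  qed
qed

section \<open>Germs of affine functions along a differential valuation\<close>

text \<open>Summation by parts with ratio r = m / m'. The weights telescope to 1 and are nonnegative
  when m is at most m', so the right-hand side is then a convex combination.\<close>

lemma dv_vertex_mono_combination:
  assumes "1 \<le> m"
  shows "dv_vertex U m' k =
    (\<Sum>i<k. ((real m / real m') ^ i - (real m / real m') ^ Suc i) *\<^sub>R dv_vertex U m i) +
    (real m / real m') ^ k *\<^sub>R dv_vertex U m k"
proof (induction k)
  case 0
  show ?case by (simp add: dv_vertex_def)
next
  case (Suc k)
  let ?r = "real m / real m'"
  have "dv_vertex U m' (Suc k) = dv_vertex U m' k + (1 / real m' ^ Suc k) *\<^sub>R (U ! Suc k)"
    by (simp add: dv_vertex_def)
  also have "1 / real m' ^ Suc k = ?r ^ Suc k * (1 / real m ^ Suc k)"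
    using assms by (simp add: power_divide)
  also have "(?r ^ Suc k * (1 / real m ^ Suc k)) *\<^sub>R (U ! Suc k) =
      ?r ^ Suc k *\<^sub>R (dv_vertex U m (Suc k) - dv_vertex U m k)"
    by (simp add: dv_vertex_def)
  finally show ?case
    unfolding Suc.IH by (simp add: algebra_simps)
qed

lemma dv_simplex_antimono:
  assumes "1 \<le> m" "m \<le> m'"
  shows "dv_simplex U m' \<subseteq> dv_simplex U m"
  unfolding dv_simplex_def[of U m']
proof (intro hull_minimal)
  define r where "r = real m / real m'"
  have r: "0 \<le> r" "r \<le> 1" using assms by (auto simp: r_def)
  show "dv_vertex U m' ` {..<length U} \<subseteq> dv_simplex U m"
  proof safe
    fix k assume k: "k < length U"
    have v: "dv_vertex U m i \<in> dv_simplex U m" if "i \<le> k" for i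
      unfolding dv_simplex_def using that k by (intro hull_inc) auto
    define a where "a i = (if i < k then r ^ i - r ^ Suc i else r ^ k)" for i
    have atMost: "{..k} = insert k {..<k}" by auto
    have "(\<Sum>i\<le>k. a i *\<^sub>R dv_vertex U m i) \<in> dv_simplex U m"
    proof (intro convex_sum)
      show "convex (dv_simplex U m)" by (simp add: dv_simplex_def)
      have "(\<Sum>i<k. r ^ i - r ^ Suc i) = 1 - r ^ k"
        using sum_lessThan_telescope'[of "\<lambda>i. r ^ i" k] by simp
      then show "sum a {..k} = 1" by (simp add: atMost a_def)
      show "0 \<le> a i" for i
        using r power_decreasing[of i "Suc i" r] by (auto simp: a_def)
    qed (use v in auto)
    also have "(\<Sum>i\<le>k. a i *\<^sub>R dv_vertex U m i) = dv_vertex U m' k"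
      unfolding dv_vertex_mono_combination[OF assms(1), of U m' k] r_def[symmetric] atMost
      by (simp add: a_def)
    finally show "dv_vertex U m' k \<in> dv_simplex U m" .
  qed
qed (simp add: dv_simplex_def)

section \<open>Soundness\<close>

lemma truth_value_bounds:
  assumes "v \<in> unit_cube"
  shows "0 \<le> truth_value A v" "truth_value A v \<le> 1"
  using assms by (induction A) (auto simp: unit_cube_def mv_neg_def mv_oplus_def)

lemma truth_value_axiom:
  assumes "luk_axiom A" "v \<in> unit_cube"
  shows "truth_value A v = 1"
  using assms(1)
proof cases
  case (A1 B C)
  then show ?thesis
    using truth_value_bounds[OF assms(2), of B] truth_value_bounds[OF assms(2), of C]
    by (auto simp: mv_neg_def mv_oplus_def min_def)
next
  case (A2 B C D)
  then show ?thesis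
    using truth_value_bounds[OF assms(2), of B] truth_value_bounds[OF assms(2), of C]
      truth_value_bounds[OF assms(2), of D] by (auto simp: mv_neg_def mv_oplus_def min_def)
next
  case (A3 B C)
  then show ?thesis
    using truth_value_bounds[OF assms(2), of B] truth_value_bounds[OF assms(2), of C]
    by (auto simp: mv_neg_def mv_oplus_def min_def)
next
  case (A4 B C)
  then show ?thesis by (auto simp: mv_neg_def mv_oplus_def min_def)
qed

lemma derives_dv_satisfies:
  assumes "\<Theta> \<turnstile> \<psi>" "differential_valuation U" "\<And>\<theta>. \<theta> \<in> \<Theta> \<Longrightarrow> dv_satisfies U \<theta>"
  shows "dv_satisfies U \<psi>"
  using assms(1)
proof induction
  case (ax A)
  have "\<forall>\<^sub>F m in sequentially. dv_simplex U m \<subseteq> unit_cube \<and> m \<ge> 1"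
    using assms(2) eventually_ge_at_top by (auto simp: differential_valuation_def intro: eventually_conj)
  then obtain m where "dv_simplex U m \<subseteq> unit_cube" "m \<ge> 1"
    using eventually_happens'[OF sequentially_bot] by blast
  then show ?case using truth_value_axiom[OF ax] by (auto simp: dv_satisfies_def)
next
  case (hyp A)
  then show ?case by (rule assms(3))
next
  case (mp A B)
  obtain m where m: "m \<ge> 1" "dv_simplex U m \<subseteq> unit_cube" "\<And>v. v \<in> dv_simplex U m \<Longrightarrow> truth_value A v = 1"
    using mp.IH(1) by (auto simp: dv_satisfies_def)
  obtain m' where m': "m' \<ge> 1" "\<And>v. v \<in> dv_simplex U m' \<Longrightarrow> truth_value (A \<^bold>\<rightarrow> B) v = 1"
    using mp.IH(2) by (auto simp: dv_satisfies_def)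
  \<comment> \<open>The two premises may be satisfied at different indices; the simplex at the
    larger one lies in both.\<close>
  let ?k = "max m m'"
  have sub: "dv_simplex U ?k \<subseteq> dv_simplex U m" "dv_simplex U ?k \<subseteq> dv_simplex U m'"
    using m(1) m'(1) by (simp_all add: dv_simplex_antimono)
  have "truth_value B v \<ge> 1" "truth_value B v \<le> 1" if "v \<in> dv_simplex U ?k" for v
  proof -
    have "truth_value A v = 1" "truth_value (A \<^bold>\<rightarrow> B) v = 1" using that sub m m' by blast+
    then show "truth_value B v \<ge> 1" by (simp add: mv_neg_def mv_oplus_def)
    show "truth_value B v \<le> 1"
      using that sub m(2) by (intro truth_value_bounds) blast
  qed
  then show ?case
    unfolding dv_satisfies_def using sub m by (intro exI[of _ ?k]) (auto intro: antisym)
qed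

section \<open>Eventual signs of affine functions\<close>

text \<open>A positive leading coefficient eventually dominates the rest; a zero one is removed by
  induction. All partial sums are needed, since each is the value at one vertex.\<close>

lemma eventually_lex_nonneg:
  "lex_nonneg cs \<Longrightarrow> \<forall>\<^sub>F m in sequentially. \<forall>k<length cs. 0 \<le> (\<Sum>i\<le>k. cs ! i / real m ^ i)"
proof (induction cs)
  case Nil
  show ?case by simp
next
  case (Cons c cs)
  have shift: "(\<Sum>i\<le>Suc k. (c # cs) ! i / real m ^ i) = c + (\<Sum>i\<le>k. cs ! i / real m ^ i) / real m"
    for k m
    unfolding sum.atMost_Suc_shift by (simp add: sum_divide_distrib mult.commute)
  show ?case
  proof (cases "c > 0")
    case True
    \<comment> \<open>For m at least 1 this bounds every partial sum of the tail, so
      \<open>S / real m\<close> at most \<open>c\<close> suffices.\<close>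
    define S where "S = (\<Sum>i<length cs. \<bar>cs ! i\<bar>)"
    have "\<forall>\<^sub>F m in sequentially. real m \<ge> max 1 (S / c)"
      using filterlim_real_sequentially unfolding filterlim_at_top by blast
    then show ?thesis
    proof eventually_elim
      case (elim m)
      then have m: "real m \<ge> 1" "S / real m \<le> c" using True by (auto simp: field_simps)
      have "0 \<le> (\<Sum>i\<le>k. (c # cs) ! i / real m ^ i)" if "k < length (c # cs)" for k
      proof (cases k)
        case 0
        then show ?thesis using True by simp
      next
        case (Suc j)
        have "\<bar>\<Sum>i\<le>j. cs ! i / real m ^ i\<bar> \<le> (\<Sum>i\<le>j. \<bar>cs ! i / real m ^ i\<bar>)" by (rule sum_abs)
        also have "\<dots> \<le> (\<Sum>i\<le>j. \<bar>cs ! i\<bar>)"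
        proof (intro sum_mono)
          fix i
          have "1 \<le> real m ^ i" using m(1) by (rule one_le_power)
          then show "\<bar>cs ! i / real m ^ i\<bar> \<le> \<bar>cs ! i\<bar>"
            by (simp add: divide_le_eq mult_le_cancel_left1)
        qed
        also have "\<dots> \<le> S"
          unfolding S_def using that Suc by (intro sum_mono2) auto
        finally have "\<bar>\<Sum>i\<le>j. cs ! i / real m ^ i\<bar> / real m \<le> S / real m"
          using m(1) by (intro divide_right_mono) auto
        then have "\<bar>(\<Sum>i\<le>j. cs ! i / real m ^ i) / real m\<bar> \<le> c"
          using m by (simp add: abs_divide)
        then show ?thesis unfolding Suc shift by linarith
      qed
      then show ?case by blast
    qed
  next
    case False
    then have "c = 0" "lex_nonneg cs" using Cons.prems by auto
    from Cons.IH[OF this(2)] show ?thesis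
    proof eventually_elim
      case (elim m)
      have "0 \<le> (\<Sum>i\<le>k. (c # cs) ! i / real m ^ i)" if "k < length (c # cs)" for k
      proof (cases k)
        case (Suc j)
        then show ?thesis using that elim \<open>c = 0\<close> unfolding Suc shift by simp
      qed (simp add: \<open>c = 0\<close>)
      then show ?case by blast
    qed
  qed
qed

lemma lex_nonneg_zero: "(\<And>i. i < length cs \<Longrightarrow> cs ! i = 0) \<Longrightarrow> lex_nonneg cs"
proof (induction cs)
  case (Cons c cs)
  then show ?case using Cons.prems[of 0] Cons.prems[of "Suc _"] by auto
qed simp

text \<open>These are the coefficients, in powers of 1 / m, of the affine function with gradient
  \<open>z\<close> and constant \<open>s\<close> at the vertices: vertex k takes the partial sum up
  to k. The constant enters only at the base point.\<close>

definition affine_germ :: "(real ^ 'n) list \<Rightarrow> real ^ 'n \<Rightarrow> real \<Rightarrow> real list" where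
  "affine_germ U z s = (U ! 0 \<bullet> z + s) # map (\<lambda>u. u \<bullet> z) (tl U)"

lemma length_affine_germ: "U \<noteq> [] \<Longrightarrow> length (affine_germ U z s) = length U"
  by (simp add: affine_germ_def)

lemma affine_dv_vertex:
  assumes "k < length U"
  shows "z \<bullet> dv_vertex U m k + s = (\<Sum>i\<le>k. affine_germ U z s ! i / real m ^ i)"
proof -
  have "z \<bullet> dv_vertex U m k + s = (\<Sum>i\<le>k. (U ! i \<bullet> z) / real m ^ i) + s"
    by (simp add: dv_vertex_def inner_sum_right inner_commute)
  also have "\<dots> = (\<Sum>i\<le>k. affine_germ U z s ! i / real m ^ i)"
  proof (cases k)
    case 0
    then show ?thesis by (simp add: affine_germ_def)
  next
    case (Suc j)
    have "affine_germ U z s ! Suc i = U ! Suc i \<bullet> z" if "i \<le> j" for i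
    proof -
      have "i < length (tl U)" using that assms Suc by simp
      then show ?thesis by (simp add: affine_germ_def nth_tl)
    qed
    moreover have "affine_germ U z s ! 0 = U ! 0 \<bullet> z + s" by (simp add: affine_germ_def)
    ultimately show ?thesis
      unfolding Suc sum.atMost_Suc_shift by (simp cong: sum.cong_simp)
  qed
  finally show ?thesis .
qed

text \<open>A closed half-space is convex, so it is enough to check the vertices, whose values are
  the partial sums of the germ.\<close>

lemma eventually_affine_nonneg:
  assumes "lex_nonneg (affine_germ U z s)" "U \<noteq> []"
  shows "\<forall>\<^sub>F m in sequentially. \<forall>x\<in>dv_simplex U m. 0 \<le> z \<bullet> x + s"
  using eventually_lex_nonneg[OF assms(1)]
proof eventually_elim
  case (elim m)
  have "dv_simplex U m \<subseteq> {x. z \<bullet> x \<ge> - s}"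
    unfolding dv_simplex_def
  proof (intro hull_minimal)
    show "dv_vertex U m ` {..<length U} \<subseteq> {x. z \<bullet> x \<ge> - s}"
    proof safe
      fix k assume "k < length U"
      then have "0 \<le> z \<bullet> dv_vertex U m k + s"
        using elim assms(2) by (simp add: affine_dv_vertex length_affine_germ)
      then show "- s \<le> z \<bullet> dv_vertex U m k" by simp
    qed
  qed (rule convex_halfspace_ge)
  then show ?case by fastforce
qed

text \<open>Vanishing on a single simplex kills all partial sums, and their successive differences
  are the scaled coefficients.\<close>

lemma lex_nonneg_affine_zero:
  assumes "m \<ge> 1" "\<And>x. x \<in> dv_simplex U m \<Longrightarrow> z \<bullet> x + s = 0" "U \<noteq> []"
  shows "lex_nonneg (affine_germ U z s)"
proof (rule lex_nonneg_zero)
  fix i assume i: "i < length (affine_germ U z s)"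
  have sum: "(\<Sum>i\<le>k. affine_germ U z s ! i / real m ^ i) = 0" if "k < length U" for k
  proof -
    have "dv_vertex U m k \<in> dv_simplex U m"
      unfolding dv_simplex_def using that by (intro hull_inc) auto
    then show ?thesis using assms(2) affine_dv_vertex[OF that] by metis
  qed
  have "affine_germ U z s ! i / real m ^ i = 0"
  proof (cases i)
    case 0
    then show ?thesis using sum[of 0] assms(3) by simp
  next
    case (Suc j)
    then show ?thesis
      using sum[of "Suc j"] sum[of j] i assms(3) by (simp add: length_affine_germ)
  qed
  then show "affine_germ U z s ! i = 0" using assms(1) by simp
qed

section \<open>The positive cone of a chain\<close>

text \<open>\<open>None\<close> counts the unit and \<open>Some i\<close> a variable, so an integer
  pair \<open>(z, s)\<close> is both a group element and an affine function.\<close>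

definition count_vec :: "'n option multiset \<Rightarrow> (real ^ 'n) \<times> real" where
  "count_vec M = (\<chi> i. real (count M (Some i)), real (count M None))"

lemma count_vec_add: "count_vec (M + N) = count_vec M + count_vec N"
  by (simp add: count_vec_def vec_eq_iff)

lemma count_vec_inject: "count_vec M = count_vec N \<longleftrightarrow> M = N"
proof
  assume *: "count_vec M = count_vec N"
  show "M = N"
  proof (rule multiset_eqI)
    fix x show "count M x = count N x"
      using * by (cases x) (simp_all add: count_vec_def vec_eq_iff)
  qed
qed simp

lemma int_points_prod_iff:
  fixes z :: "real ^ 'n" and s :: real
  shows "(z, s) \<in> int_points \<longleftrightarrow> z \<in> int_points \<and> s \<in> \<int>"
  by (auto simp: int_points_def Basis_prod_def ball_Un)

lemma int_points_vec_iff: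
  fixes z :: "real ^ 'n"
  shows "z \<in> int_points \<longleftrightarrow> (\<forall>i. z $ i \<in> \<int>)"
  by (auto simp: int_points_def Basis_vec_def inner_axis)

lemma count_vec_int: "count_vec M - count_vec N \<in> int_points"
  by (simp add: count_vec_def int_points_prod_iff int_points_vec_iff)

lemma ex_count_vec_diff:
  fixes z :: "(real ^ 'n) \<times> real"
  assumes "z \<in> int_points"
  obtains M N where "z = count_vec M - count_vec N"
proof -
  obtain a c where z: "z = (a, c)" by fastforce
  define co where "co x = \<lfloor>case x of None \<Rightarrow> c | Some i \<Rightarrow> a $ i\<rfloor>" for x
  have co: "of_int (co None) = c" "of_int (co (Some i)) = a $ i" for i
    using assms by (auto simp: z int_points_prod_iff int_points_vec_iff co_def)
  have cnt: "count (Abs_multiset f) = f" for f :: "'n option \<Rightarrow> nat"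
    by (simp add: Abs_multiset_inverse)
  have nat: "real (nat k) - real (nat (- k)) = of_int k" for k :: int
    by (cases "k \<ge> 0") auto
  \<comment> \<open>The two multisets are the positive and negative parts of the
    coordinates.\<close>
  have "z = count_vec (Abs_multiset (\<lambda>x. nat (co x))) - count_vec (Abs_multiset (\<lambda>x. nat (- co x)))"
    by (simp add: z count_vec_def cnt vec_eq_iff nat co)
  then show ?thesis by (rule that)
qed

context bck_chain
begin

context
  fixes gen :: "'n::finite option \<Rightarrow> 'a"
  assumes gen_None: "gen None = one"
begin

definition pos_cone :: "((real ^ 'n) \<times> real) set" where
  "pos_cone = {count_vec M - count_vec N | M N. mle (image_mset gen N) (image_mset gen M)}"

text \<open>Two representations of one point satisfy M + N' = M' + N, so cancellation makes
  membership independent of the representation.\<close>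

lemma pos_cone_iff: "count_vec M - count_vec N \<in> pos_cone \<longleftrightarrow> mle (image_mset gen N) (image_mset gen M)"
proof
  assume "count_vec M - count_vec N \<in> pos_cone"
  then obtain M' N' where *: "count_vec M - count_vec N = count_vec M' - count_vec N'"
    "mle (image_mset gen N') (image_mset gen M')" by (auto simp: pos_cone_def)
  then have "count_vec (M + N') = count_vec (M' + N)"
    by (simp add: count_vec_add algebra_simps)
  then have eq: "M + N' = M' + N" by (simp only: count_vec_inject)
  have "mle (image_mset gen N' + image_mset gen N) (image_mset gen M' + image_mset gen N)"
    using *(2) by (simp add: mle_add_right)
  then have "mle (image_mset gen (N + N')) (image_mset gen (M + N'))"
    unfolding eq by (simp add: add.commute)
  then show "mle (image_mset gen N) (image_mset gen M)"
    by (simp add: mle_add_right)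
qed (auto simp: pos_cone_def)

lemma int_group_preorder_pos_cone: "int_group_preorder int_points pos_cone"
proof
  show "x - y \<in> int_points" if "x \<in> int_points" "y \<in> int_points" for x y :: "(real ^ 'n) \<times> real"
    using that by (simp add: int_points_def inner_diff_left)
  show "x + y \<in> pos_cone" if x: "x \<in> pos_cone" and y: "y \<in> pos_cone" for x y
  proof -
    obtain M N where M: "x = count_vec M - count_vec N" "mle (image_mset gen N) (image_mset gen M)"
      using x by (auto simp: pos_cone_def)
    obtain M' N' where M': "y = count_vec M' - count_vec N'" "mle (image_mset gen N') (image_mset gen M')"
      using y by (auto simp: pos_cone_def)
    have "x + y = count_vec (M + M') - count_vec (N + N')"
      by (simp add: M M' count_vec_add)
    then show ?thesis using mle_add[OF M(2) M'(2)] by (simp add: pos_cone_iff)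
  qed
  show "x \<in> pos_cone \<or> - x \<in> pos_cone" if int: "x \<in> int_points" for x
  proof -
    obtain M N where x: "x = count_vec M - count_vec N" using int by (rule ex_count_vec_diff)
    then have "- x = count_vec N - count_vec M" by simp
    then show ?thesis unfolding x using pos_cone_iff mle_total by metis
  qed
qed (simp_all add: int_points_def)

lemma unit_pos_cone: "(0, -1) \<notin> pos_cone"
proof -
  have "(0, -1) = count_vec {#} - count_vec {#None :: 'n option#}"
    by (simp add: count_vec_def zero_prod_def vec_eq_iff)
  then show ?thesis
    using not_Z_one by (simp add: pos_cone_iff gen_None mle_single_empty)
qed

text \<open>Generators lie between zero and the unit; this is what keeps the simplices inside the
  cube.\<close>

lemma axis_pos_cone: "(axis i 1, 0) \<in> pos_cone" "(- axis i 1, 1) \<in> pos_cone"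
proof -
  have "(axis i 1, 0) = count_vec {#Some i#} - count_vec {#}"
    by (simp add: count_vec_def vec_eq_iff axis_def)
  then show "(axis i 1, 0) \<in> pos_cone"
    by (simp only: pos_cone_iff) (simp add: mle_empty)
  have "(- axis i 1, 1) = count_vec {#None#} - count_vec {#Some i#}"
    by (simp add: count_vec_def vec_eq_iff axis_def)
  then show "(- axis i 1, 1) \<in> pos_cone"
    by (simp only: pos_cone_iff) (simp add: mle_single gen_None le_one)
qed

text \<open>The first functional is taken on pairs \<open>(z, s)\<close>. The others are taken on
  the projection of its integral kernel to the first component, so that they are orthonormal in
  n-dimensional space itself and at most n in number.\<close>

lemma ex_tuple_pos_cone:
  obtains U :: "(real ^ 'n) list" where "differential_valuation U" "U \<noteq> []"
    "\<And>z s. (z, s) \<in> int_points \<Longrightarrow> (z, s) \<in> pos_cone \<longleftrightarrow> lex_nonneg (affine_germ U z s)"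
proof -
  interpret G: int_group_preorder "int_points :: ((real ^ 'n) \<times> real) set" pos_cone
    by (rule int_group_preorder_pos_cone)
  have "(0, -1) \<in> (int_points :: ((real ^ 'n) \<times> real) set)"
    by (simp add: int_points_prod_iff int_points_vec_iff)
  then have "\<not> (int_points :: ((real ^ 'n) \<times> real) set) \<subseteq> pos_cone" using unit_pos_cone by blast
  then obtain w :: "(real ^ 'n) \<times> real" where "w \<noteq> 0"
    and w: "\<And>z. z \<in> int_points \<Longrightarrow> w \<bullet> z > 0 \<Longrightarrow> z \<in> pos_cone"
      "\<And>z. z \<in> int_points \<Longrightarrow> w \<bullet> z < 0 \<Longrightarrow> z \<notin> pos_cone"
    by (rule G.ex_first_functional) blast
  obtain a c where ac: "w = (a, c)" by fastforce
  have "a $ i \<ge> 0 \<and> c - a $ i \<ge> 0" for i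
  proof -
    have i: "(axis i 1, 0) \<in> (int_points :: ((real ^ 'n) \<times> real) set)"
      "(- axis i 1, 1) \<in> (int_points :: ((real ^ 'n) \<times> real) set)"
      by (auto simp: int_points_prod_iff int_points_vec_iff axis_def)
    show ?thesis
      using w(2)[OF i(1)] w(2)[OF i(2)] axis_pos_cone[of i]
      by (auto simp: ac inner_axis intro!: leI)
  qed
  then have ai: "a $ i \<ge> 0" "a $ i \<le> c" for i by (simp_all add: field_simps)
  \<comment> \<open>Every coordinate of \<open>a\<close> lies between 0 and \<open>c\<close>, so
    \<open>c = 0\<close> would make the functional zero.\<close>
  have "c \<noteq> 0"
  proof
    assume "c = 0"
    then have "a = 0" using ai by (simp add: vec_eq_iff antisym)
    then show False using \<open>c = 0\<close> \<open>w \<noteq> 0\<close> by (simp add: ac zero_prod_def)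
  qed
  then have c: "c > 0" using ai[of undefined] by linarith
  define u where "u = (1 / c) *\<^sub>R a"
  have wu: "w \<bullet> (z, s) = c * (u \<bullet> z + s)" for z s
    using c by (simp add: ac u_def algebra_simps)
  \<comment> \<open>\<open>L\<close> consists of the integer \<open>z\<close> for which some integer
    \<open>s\<close> puts \<open>(z, s)\<close> in the kernel of the first functional; that
    \<open>s\<close> is minus \<open>u \<bullet> z\<close>, and \<open>P\<close> is the cone read
    along it.\<close>
  define L where "L = {z \<in> int_points. u \<bullet> z \<in> \<int>}"
  define P where "P = {z. (z, - (u \<bullet> z)) \<in> pos_cone}"
  have "int_group_preorder L P"
  proof
    show "x - y \<in> L" if "x \<in> L" "y \<in> L" for x y
      using that by (simp add: L_def int_points_def inner_diff_left inner_diff_right)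
    show "x + y \<in> P" if "x \<in> P" "y \<in> P" for x y
      using G.P_add[of "(x, - (u \<bullet> x))" "(y, - (u \<bullet> y))"] that
      by (simp add: P_def inner_add_right)
    show "x \<in> P \<or> - x \<in> P" if "x \<in> L" for x
      using G.P_total[of "(x, - (u \<bullet> x))"] that
      by (simp add: P_def L_def int_points_prod_iff)
  qed (auto simp: L_def int_points_def)
  then obtain us where us: "length us \<le> dim (UNIV :: (real ^ 'n) set)" "\<forall>w\<in>set us. norm w = 1"
      "sorted_wrt orthogonal us" "\<forall>z\<in>L. z \<in> P \<longleftrightarrow> lex_nonneg (map (\<lambda>w. w \<bullet> z) us)"
    using ex_lexicographic_representation[of L P UNIV] by auto
  define U where "U = u # us"
  have cone: "(z, s) \<in> pos_cone \<longleftrightarrow> lex_nonneg (affine_germ U z s)" if "(z, s) \<in> int_points" for z s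
  proof -
    consider "u \<bullet> z + s > 0" | "u \<bullet> z + s < 0" | "u \<bullet> z + s = 0" by linarith
    then show ?thesis
    proof cases
      case 1
      then show ?thesis using w(1)[OF that] c by (simp add: wu U_def affine_germ_def)
    next
      case 2
      then show ?thesis using w(2)[OF that] c by (simp add: wu U_def affine_germ_def mult_pos_neg)
    next
      case 3
      then have s: "s = - (u \<bullet> z)" by simp
      then have "z \<in> L" using that by (simp add: L_def int_points_prod_iff)
      then show ?thesis using us(4) 3 s by (simp add: P_def U_def affine_germ_def)
    qed
  qed
  have U: "U \<noteq> []" by (simp add: U_def)
  \<comment> \<open>The coordinate functions and their complements belong to the cone, so they are
    eventually nonnegative on the simplices.\<close>
  have "\<forall>\<^sub>F m in sequentially. \<forall>i. \<forall>x\<in>dv_simplex U m. 0 \<le> x $ i \<and> x $ i \<le> 1"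
  proof (rule eventually_all_finite)
    fix i
    have i: "lex_nonneg (affine_germ U (axis i 1) 0)" "lex_nonneg (affine_germ U (- axis i 1) 1)"
      using axis_pos_cone[of i] cone by (auto simp: int_points_prod_iff int_points_vec_iff axis_def)
    show "\<forall>\<^sub>F m in sequentially. \<forall>x\<in>dv_simplex U m. 0 \<le> x $ i \<and> x $ i \<le> 1"
      using eventually_affine_nonneg[OF i(1) U] eventually_affine_nonneg[OF i(2) U]
      by eventually_elim (auto simp: inner_axis')
  qed
  then have "\<forall>\<^sub>F m in sequentially. dv_simplex U m \<subseteq> unit_cube"
    by eventually_elim (auto simp: unit_cube_def)
  moreover have "\<forall>i\<in>{1..length us}. norm (U ! i) = 1"
    using us(2) by (auto simp: U_def nth_Cons')
  moreover have "orthogonal (U ! i) (U ! j)"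
    if "i \<in> {1..length us}" "j \<in> {1..length us}" "i \<noteq> j" for i j
  proof -
    have "orthogonal (us ! k) (us ! l)" if "k < l" "l < length us" for k l
      using us(3) that by (simp add: sorted_wrt_iff_nth_less)
    then have "orthogonal (us ! k) (us ! l)" if "k \<noteq> l" "k < length us" "l < length us" for k l
      using that by (metis linorder_neqE_nat orthogonal_commute)
    from this[of "i - 1" "j - 1"] show ?thesis
      using that by (auto simp: U_def nth_Cons')
  qed
  ultimately have "differential_valuation U"
    using us(1) unfolding differential_valuation_def
    by (intro conjI exI[of _ "length us"]) (auto simp: U_def)
  then show ?thesis using that U cone by blast
qed

end

end

section \<open>Completeness\<close>

text \<open>Each formula has an integer affine function that equals its deficit in the group of the
  chain and, eventually, its numerical deficit on the simplices. Derivability and satisfaction both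
  say that this function is zero.\<close>

lemma ex_differential_valuation_of_prime:
  fixes T :: "('n::finite) form set"
  assumes "\<not> T \<turnstile> \<psi>" and prime: "\<And>A B. T \<turnstile> A \<^bold>\<rightarrow> B \<or> T \<turnstile> B \<^bold>\<rightarrow> A"
  obtains U where "differential_valuation U" "\<And>\<phi>. dv_satisfies U \<phi> \<longleftrightarrow> T \<turnstile> \<phi>"
proof -
  interpret bck_chain "\<lambda>A B. B \<^bold>\<rightarrow> A" "derives T" bot_form
  proof
    show "\<not> T \<turnstile> bot_form" using assms(1) mp derives_bot by blast
  qed (rule prime)
  \<comment> \<open>The deficit of \<open>Neg (Var i)\<close> is the value of the variable \<open>i\<close>.\<close>
  define gen :: "'n option \<Rightarrow> 'n form" where
    "gen x = (case x of None \<Rightarrow> bot_form | Some i \<Rightarrow> Neg (Var i))" for x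
  have gen: "gen None = bot_form" "gen (Some i) = Neg (Var i)" for i by (simp_all add: gen_def)
  let ?I = "image_mset gen" and ?P = "pos_cone gen"
  let ?aff = "\<lambda>M N x. fst (count_vec M - count_vec N) \<bullet> x + snd (count_vec M - count_vec N)"
  have cone_iff: "count_vec M - count_vec N \<in> ?P \<longleftrightarrow> mle (?I N) (?I M)" for M N
    by (rule pos_cone_iff) (rule gen)
  obtain U :: "(real ^ 'n) list" where U: "differential_valuation U" "U \<noteq> []"
    and cone: "\<And>z s. (z, s) \<in> int_points \<Longrightarrow> (z, s) \<in> ?P \<longleftrightarrow> lex_nonneg (affine_germ U z s)"
    using ex_tuple_pos_cone[of gen] gen(1) by blast
  define meq where "meq M N \<longleftrightarrow> mle M N \<and> mle N M" for M N
  have meq_add: "meq (M + M') (N + N')" if "meq M N" "meq M' N'" for M N M' N'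
    using that mle_add by (auto simp: meq_def)
  have meq_refl: "meq M M" for M by (simp add: meq_def mle_refl)
  have meq_trans [trans]: "meq M K" if "meq M N" "meq N K" for M N K
    using that mle_trans by (auto simp: meq_def)
  have meq_sym: "meq M N \<Longrightarrow> meq N M" for M N by (simp add: meq_def)
  \<comment> \<open>The deficits of a formula and its negation add up to the unit, through the
    implication of falsity as an untruncated difference.\<close>
  have meq_Neg: "meq {#Neg A, A#} {#bot_form#}" for A
  proof -
    have "mle {#Neg A#} {#A \<^bold>\<rightarrow> bot_form#}" "mle {#A \<^bold>\<rightarrow> bot_form#} {#Neg A#}"
      using derives_Neg[of T A] derives_imp_bot[of T A] by (simp_all add: mle_single luk.le_def)
    then have "meq ({#Neg A#} + {#A#}) ({#A \<^bold>\<rightarrow> bot_form#} + {#A#})"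
      by (intro meq_add meq_refl) (simp add: meq_def)
    also have "meq \<dots> {#bot_form#}"
      using mle_mns[OF luk.le_one, of A] by (simp add: meq_def add_mset_commute)
    finally show ?thesis by (simp add: add_mset_commute)
  qed

  \<comment> \<open>In the ordered group generated by the chain, the deficit of \<open>\<phi>\<close> is the integer
    combination with coefficients \<open>count_vec M - count_vec N\<close> of the variables and the unit.\<close>
  define rep where "rep \<phi> M N \<longleftrightarrow> meq ({#\<phi>#} + ?I N) (?I M) \<and>
      (\<forall>\<^sub>F m in sequentially. \<forall>x\<in>dv_simplex U m.
        1 - truth_value \<phi> x = ?aff M N x)"
    for \<phi> M N
  have germ: "\<forall>\<^sub>F m in sequentially. \<forall>x\<in>dv_simplex U m.
      0 \<le> ?aff M N x"
    if "mle (?I N) (?I M)" for M N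
  proof (rule eventually_affine_nonneg[OF _ U(2)])
    show "lex_nonneg (affine_germ U (fst (count_vec M - count_vec N)) (snd (count_vec M - count_vec N)))"
      using cone[of "fst (count_vec M - count_vec N)" "snd (count_vec M - count_vec N)"]
        cone_iff[of M N] that count_vec_int[of M N] by (simp only: prod.collapse)
  qed
  have rep: "\<exists>M N. rep \<phi> M N" for \<phi>
  proof (induction \<phi>)
    case (Var i)
    have "meq ({#Var i#} + ?I {#Some i#}) (?I {#None#})"
      using meq_Neg[of "Var i"] by (simp add: gen add_mset_commute)
    moreover have "1 - x $ i = ?aff {#None#} {#Some i#} x" for x :: "real ^ 'n"
    proof -
      have "count_vec {#None#} - count_vec {#Some i#} = (- axis i 1, 1)"
        by (simp add: count_vec_def vec_eq_iff axis_def)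
      then show ?thesis by (simp add: inner_axis')
    qed
    ultimately have "rep (Var i) {#None#} {#Some i#}"
      unfolding rep_def truth_value.simps by (intro conjI always_eventually allI ballI)
    then show ?case by blast
  next
    case (Neg A)
    then obtain M N where A: "rep A M N" by blast
    have "meq ({#Neg A#} + ?I M) ({#Neg A#} + ({#A#} + ?I N))"
      using A by (intro meq_add meq_refl) (simp add: rep_def meq_sym)
    also have "{#Neg A#} + ({#A#} + ?I N) = {#Neg A, A#} + ?I N" by simp
    also have "meq \<dots> ({#bot_form#} + ?I N)"
      by (intro meq_add meq_refl meq_Neg)
    finally have "meq ({#Neg A#} + ?I M) (?I (add_mset None N))" by (simp add: gen)
    moreover have *: "count_vec (add_mset None N) - count_vec M = (0, 1) - (count_vec M - count_vec N)"
      by (simp add: count_vec_def vec_eq_iff)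
    have "\<forall>\<^sub>F m in sequentially. \<forall>x\<in>dv_simplex U m.
        1 - truth_value (Neg A) x = ?aff (add_mset None N) M x"
    proof -
      have "\<forall>\<^sub>F m in sequentially. \<forall>x\<in>dv_simplex U m.
        1 - truth_value A x = ?aff M N x"
        using A by (simp add: rep_def)
      then show ?thesis
        unfolding * by eventually_elim (auto simp: mv_neg_def inner_diff_left)
    qed
    ultimately show ?case unfolding rep_def by blast
  next
    case (Imp A B)
    then obtain M N M' N' where A: "rep A M N" and B: "rep B M' N'" by blast
    have evA: "\<forall>\<^sub>F m in sequentially. \<forall>x\<in>dv_simplex U m.
        1 - truth_value A x = ?aff M N x"
      and evB: "\<forall>\<^sub>F m in sequentially. \<forall>x\<in>dv_simplex U m.
        1 - truth_value B x = ?aff M' N' x"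
      and mA: "meq ({#A#} + ?I N) (?I M)" and mB: "meq ({#B#} + ?I N') (?I M')"
      using A B by (simp_all add: rep_def)
    have diff: "count_vec (M + N') - count_vec (M' + N) =
        (count_vec M - count_vec N) - (count_vec M' - count_vec N')" for M N M' N' :: "'n option multiset"
      by (simp add: count_vec_add)
    have sumA: "meq ({#A#} + (?I N + ?I N')) (?I (M + N'))"
      using meq_add[OF mA meq_refl[of "?I N'"]] by (simp add: add.assoc)
    have sumB: "meq ({#B#} + (?I N + ?I N')) (?I (M' + N))"
      using meq_add[OF mB meq_refl[of "?I N"]] by (simp add: ac_simps)
    have order: "mle (?I (M' + N)) (?I (M + N'))" if "mle {#B#} {#A#}"
      using that sumA sumB mle_add_right[of "{#B#}" "?I N + ?I N'" "{#A#}"] mle_trans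
      unfolding meq_def by blast
    have order': "mle (?I (M + N')) (?I (M' + N))" if "mle {#A#} {#B#}"
      using that sumA sumB mle_add_right[of "{#A#}" "?I N + ?I N'" "{#B#}"] mle_trans
      unfolding meq_def by blast
    show ?case
    \<comment> \<open>As \<open>T\<close> is prime, one of the two implications is derivable. Hence
      the deficit of the implication is either zero or the difference of the deficits, and the same
      choice is correct on all late simplices.\<close>
    proof (cases "T \<turnstile> A \<^bold>\<rightarrow> B")
      case True
      then have "meq {#A \<^bold>\<rightarrow> B#} {#}" by (simp add: meq_def mle_single_empty mle_empty)
      moreover have "mle {#B#} {#A#}" using True by (simp add: mle_single luk.le_def)
      from germ[OF order[OF this]] evA evB
      have "\<forall>\<^sub>F m in sequentially. \<forall>x\<in>dv_simplex U m. 1 - truth_value (A \<^bold>\<rightarrow> B) x = 0"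
      proof eventually_elim
        case (elim m)
        show ?case
        proof
          fix x assume "x \<in> dv_simplex U m"
          then have "0 \<le> (1 - truth_value A x) - (1 - truth_value B x)"
            using elim unfolding diff by (auto simp: inner_diff_left)
          then show "1 - truth_value (A \<^bold>\<rightarrow> B) x = 0" by (simp add: mv_neg_def mv_oplus_def)
        qed
      qed
      ultimately have "rep (A \<^bold>\<rightarrow> B) {#} {#}"
        unfolding rep_def by simp
      then show ?thesis by blast
    next
      case False
      then have AB: "luk.le T A B" using prime by (auto simp: luk.le_def)
      have "meq ({#A \<^bold>\<rightarrow> B#} + ?I (N' + M)) ({#A \<^bold>\<rightarrow> B#} + (?I N' + ({#A#} + ?I N)))"
        unfolding image_mset_union by (intro meq_add meq_refl meq_sym[OF mA])
      also have "\<dots> = {#A \<^bold>\<rightarrow> B, A#} + (?I N' + ?I N)" by simp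
      also have "meq \<dots> ({#B#} + (?I N' + ?I N))"
        using mle_mns[OF AB] by (intro meq_add meq_refl) (simp add: meq_def)
      also have "meq \<dots> (?I (M' + N))"
        using sumB by (simp add: add.commute)
      finally have "meq ({#A \<^bold>\<rightarrow> B#} + ?I (M + N')) (?I (M' + N))" by (simp add: add.commute)
      moreover have "mle {#A#} {#B#}" using AB by (simp add: mle_single)
      from germ[OF order'[OF this]] evA evB
      have "\<forall>\<^sub>F m in sequentially. \<forall>x\<in>dv_simplex U m. 1 - truth_value (A \<^bold>\<rightarrow> B) x =
        ?aff (M' + N) (M + N') x"
      proof eventually_elim
        case (elim m)
        show ?case
        proof
          fix x assume x: "x \<in> dv_simplex U m"
          have "?aff (M' + N) (M + N') x
              = (1 - truth_value B x) - (1 - truth_value A x)"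
            using elim x by (auto simp: inner_diff_left count_vec_add inner_add_left)
          moreover have "0 \<le> ?aff (M' + N) (M + N') x"
            using elim x by blast
          ultimately show "1 - truth_value (A \<^bold>\<rightarrow> B) x =
            ?aff (M' + N) (M + N') x"
            by (simp add: mv_neg_def mv_oplus_def)
        qed
      qed
      ultimately have "rep (A \<^bold>\<rightarrow> B) (M' + N) (M + N')"
        unfolding rep_def by blast
      then show ?thesis by blast
    qed
  qed
  have "dv_satisfies U \<phi> \<longleftrightarrow> T \<turnstile> \<phi>" for \<phi>
  proof -
    obtain M N where "rep \<phi> M N" using rep by blast
    then have meq: "meq ({#\<phi>#} + ?I N) (?I M)"
      and ev: "\<forall>\<^sub>F m in sequentially. \<forall>x\<in>dv_simplex U m.
        1 - truth_value \<phi> x = ?aff M N x"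
      by (simp_all add: rep_def)
    have T_iff: "T \<turnstile> \<phi> \<longleftrightarrow> mle (?I M) (?I N)"
    proof -
      have "T \<turnstile> \<phi> \<longleftrightarrow> mle ({#\<phi>#} + ?I N) ({#} + ?I N)"
        by (simp only: mle_add_right mle_single_empty)
      also have "\<dots> \<longleftrightarrow> mle (?I M) (?I N)"
        using meq mle_trans unfolding meq_def by auto
      finally show ?thesis .
    qed
    show ?thesis
    proof
      assume "dv_satisfies U \<phi>"
      then obtain m0 where m0: "m0 \<ge> 1" "\<And>v. v \<in> dv_simplex U m0 \<Longrightarrow> truth_value \<phi> v = 1"
        by (auto simp: dv_satisfies_def)
      \<comment> \<open>A later simplex lies inside the one on which the formula holds, and there
        the affine expression is exact; so it vanishes on that simplex and its germ is zero.\<close>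
      obtain m where m: "m \<ge> m0" "\<forall>x\<in>dv_simplex U m.
          1 - truth_value \<phi> x = ?aff M N x"
        using eventually_happens'[OF sequentially_bot eventually_conj[OF eventually_ge_at_top[of m0] ev]]
        by blast
      have "lex_nonneg (affine_germ U (fst (count_vec N - count_vec M)) (snd (count_vec N - count_vec M)))"
      proof (rule lex_nonneg_affine_zero[OF _ _ U(2)])
        show "m \<ge> 1" using m m0 by simp
        fix x assume x: "x \<in> dv_simplex U m"
        then have "truth_value \<phi> x = 1" using m0 m dv_simplex_antimono by blast
        then show "?aff N M x = 0"
          using m(2) x by (auto simp: inner_diff_left)
      qed
      then have "count_vec N - count_vec M \<in> ?P"
        using cone[of "fst (count_vec N - count_vec M)" "snd (count_vec N - count_vec M)"]
          count_vec_int[of N M] by (simp only: prod.collapse)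
      then show "T \<turnstile> \<phi>" using T_iff cone_iff by blast
    next
      assume T: "T \<turnstile> \<phi>"
      then have 1: "mle (?I M) (?I N)" using T_iff by simp
      \<comment> \<open>A deficit is never negative. Together with derivability this bounds the
        affine function by zero from both sides.\<close>
      have "mle ({#} + ?I N) ({#\<phi>#} + ?I N)" by (simp only: mle_add_right mle_empty)
      then have 2: "mle (?I N) (?I M)" using meq mle_trans unfolding meq_def by auto
      have "\<forall>\<^sub>F m in sequentially. m \<ge> 1 \<and> dv_simplex U m \<subseteq> unit_cube \<and>
          (\<forall>x\<in>dv_simplex U m. truth_value \<phi> x = 1)"
        using germ[OF 1] germ[OF 2] ev eventually_ge_at_top[of 1]
          U(1)[unfolded differential_valuation_def, THEN conjunct2]
      proof eventually_elim
        case (elim m)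
        have "truth_value \<phi> x = 1" if "x \<in> dv_simplex U m" for x
          using bspec[OF elim(1) that] bspec[OF elim(2) that] bspec[OF elim(3) that]
          by (simp add: inner_diff_left)
        then show ?case using elim by blast
      qed
      then show "dv_satisfies U \<phi>"
        unfolding dv_satisfies_def using eventually_happens'[OF sequentially_bot] by blast
    qed
  qed
  then show ?thesis using that U(1) by blast
qed

theorem theorem3p9:
  fixes \<Theta> :: "('n::finite) form set" and \<psi> :: "'n form"
  shows "\<Theta> \<Turnstile>\<^sub>\<partial> \<psi> \<longleftrightarrow> \<Theta> \<turnstile> \<psi>"
proof
  assume stable: "\<Theta> \<Turnstile>\<^sub>\<partial> \<psi>"
  show "\<Theta> \<turnstile> \<psi>"
  proof (rule ccontr)
    assume "\<not> \<Theta> \<turnstile> \<psi>"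
    then obtain T where T: "\<Theta> \<subseteq> T" "\<not> T \<turnstile> \<psi>" "\<And>A B. T \<turnstile> A \<^bold>\<rightarrow> B \<or> T \<turnstile> B \<^bold>\<rightarrow> A"
      using ex_prime_extension by blast
    obtain U where U: "differential_valuation U" "\<And>\<phi>. dv_satisfies U \<phi> \<longleftrightarrow> T \<turnstile> \<phi>"
      using ex_differential_valuation_of_prime[OF T(2,3)] by blast
    have "dv_satisfies U \<theta>" if "\<theta> \<in> \<Theta>" for \<theta>
      using that T(1) U(2) hyp by blast
    then have "dv_satisfies U \<psi>" using stable U(1) by (simp add: stable_consequence_def)
    then show False using U(2) T(2) by blast
  qed
next
  assume "\<Theta> \<turnstile> \<psi>"
  then show "\<Theta> \<Turnstile>\<^sub>\<partial> \<psi>"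
    unfolding stable_consequence_def using derives_dv_satisfies by blast
qed

end
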